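(* Let $T\subset\mathbb R^d$ be compact and let $f$ be a centered, unit-variance Gaussian random field on $T$. Suppose that the lattice sets $T_N$ satisfy, for some $\kappa_m>0$, $\sup_{t\in T}\min_{t'\in T_N}|t-t'|\le \kappa_m/N$ for all positive integers $N$; that $f$ is almost surely continuous; and that its correlation function $r(s,t)=E(f(s)f(t))$ satisfies, for some $\beta'>0$ and $\kappa_H'>0$, $|r(t,s)-r(t',s')|\le\kappa_H'\big(|t-t'|^{\beta'}+|s-s'|^{\beta'}\big)$ for all $s,t,s',t'\in T$. Let $\beta^*=\min(\beta,\beta')$. For $\varepsilon_0>0$ set $$N_0(\varepsilon,b)=b^{\frac{2}{\beta^*}\left(\frac{3d}{\beta^*}+2+\varepsilon_0\right)}\,\varepsilon^{-\frac{2}{\beta^*}-\varepsilon_0}.$$ Then for every $\varepsilon_0>0$ there exists a constant $b_0$ such that for every $\varepsilon\in(0,1)$, every $b>b_0$, every positive integer $N\ge N_0(\varepsilon,b)$ and every $(\mu,\sigma)\in\mathcal C(\mu_l,\mu_u,\sigma_l,\sigma_u,\beta,\kappa_H)$, $$\frac{|w_{\sigma,\mu,N}(b)-w_{\sigma,\mu}(b)|}{w_{\sigma,\mu}(b)}<\varepsilon .$$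
   Context: Fixed constants: $\mu_l\le\mu_u$ in $\mathbb R$, $0<\sigma_l\le\sigma_u<\infty$, $\beta>0$, $\kappa_H>0$. The class $\mathcal C(\mu_l,\mu_u,\sigma_l,\sigma_u,\beta,\kappa_H)$ consists of pairs of functions $\mu,\sigma:T\to\mathbb R$ such that for all $s,t\in T$: $\mu(t)\in[\mu_l,\mu_u]$, $\sigma(t)>0$, $\sigma^2(t)\in[\sigma_l^2,\sigma_u^2]$, and $|\sigma(t)-\sigma(s)|+|\mu(t)-\mu(s)|\le\kappa_H|s-t|^{\beta}$. A centered, unit-variance Gaussian random field $f$ on $T$ is one whose finite-dimensional marginals are multivariate Gaussian with $Ef(t)=0$ and $\mathrm{Var}(f(t))=1$ for all $t\in T$. For a positive integer $N$, $T_N=T\cap\{(i_1/N,\dots,i_d/N): i_1,\dots,i_d\in\mathbb Z\}$, a finite set. Define $w_{\sigma,\mu}(b)=P(\sup_{t\in T}\{\sigma(t)f(t)+\mu(t)\}>b)$ and $w_{\sigma,\mu,N}(b)=P(\sup_{t\in T_N}\{\sigma(t)f(t)+\mu(t)\}>b)$. *)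

theory Defs
  imports "HOL-Probability.Probability"
begin

definition gaussian_rv :: "'w measure \<Rightarrow> ('w \<Rightarrow> real) \<Rightarrow> bool" where
  "gaussian_rv M X \<longleftrightarrow>
     (\<exists>m s. s > 0 \<and> distributed M lborel X (normal_density m s)) \<or>
     (X \<in> borel_measurable M \<and> (\<exists>c. AE \<omega> in M. X \<omega> = c))"

text \<open>A finite family is multivariate Gaussian (the covariance may be singular) iff every linear
  combination of its components is Gaussian, where constants count as Gaussian.\<close>

definition multivariate_gaussian :: "'w measure \<Rightarrow> 'i set \<Rightarrow> ('i \<Rightarrow> 'w \<Rightarrow> real) \<Rightarrow> bool" where
  "multivariate_gaussian M I X \<longleftrightarrow>
     (\<forall>a :: 'i \<Rightarrow> real. gaussian_rv M (\<lambda>\<omega>. \<Sum>i\<in>I. a i * X i \<omega>))"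

definition std_gaussian_field :: "'w measure \<Rightarrow> 'p set \<Rightarrow> ('p \<Rightarrow> 'w \<Rightarrow> real) \<Rightarrow> bool" where
  "std_gaussian_field M T f \<longleftrightarrow>
     (\<forall>S. finite S \<and> S \<subseteq> T \<longrightarrow> multivariate_gaussian M S f) \<and>
     (\<forall>t\<in>T. prob_space.expectation M (f t) = 0 \<and> prob_space.variance M (f t) = 1)"

definition correlation_fun :: "'w measure \<Rightarrow> ('p \<Rightarrow> 'w \<Rightarrow> real) \<Rightarrow> 'p \<Rightarrow> 'p \<Rightarrow> real" where
  "correlation_fun M f s t = prob_space.expectation M (\<lambda>\<omega>. f s \<omega> * f t \<omega>)"

definition lattice_points :: "(real ^ 'd) set \<Rightarrow> nat \<Rightarrow> (real ^ 'd) set" where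
  "lattice_points T N = T \<inter> {(\<chi> j. of_int (i j) / of_nat N) | i :: 'd \<Rightarrow> int. True}"

definition param_class ::
  "(real ^ 'd) set \<Rightarrow> real \<Rightarrow> real \<Rightarrow> real \<Rightarrow> real \<Rightarrow> real \<Rightarrow> real
     \<Rightarrow> ((real ^ 'd \<Rightarrow> real) \<times> (real ^ 'd \<Rightarrow> real)) set" where
  "param_class T \<mu>l \<mu>u \<sigma>l \<sigma>u \<beta> \<kappa>H =
     {(\<mu>, \<sigma>). \<forall>s\<in>T. \<forall>t\<in>T.
        \<mu> t \<in> {\<mu>l..\<mu>u} \<and> \<sigma> t > 0 \<and> (\<sigma> t)\<^sup>2 \<in> {\<sigma>l\<^sup>2..\<sigma>u\<^sup>2} \<and>
        \<bar>\<sigma> t - \<sigma> s\<bar> + \<bar>\<mu> t - \<mu> s\<bar> \<le> \<kappa>H * norm (s - t) powr \<beta>}"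

text \<open>The probability that the supremum over \<open>S\<close> exceeds \<open>b\<close>. The supremum is taken in the extended
  reals, since on the null set of discontinuous paths it may be infinite. For uncountable \<open>S\<close> the
  event is in general determined only up to a subset of a null set, hence the completion of \<open>M\<close>
  (\<open>measure\<close> would be \<open>0\<close> on a set outside the sigma-algebra).\<close>

definition exceed_prob ::
  "'w measure \<Rightarrow> ('p \<Rightarrow> 'w \<Rightarrow> real) \<Rightarrow> 'p set \<Rightarrow> ('p \<Rightarrow> real) \<Rightarrow> ('p \<Rightarrow> real) \<Rightarrow> real \<Rightarrow> real" where
  "exceed_prob M f S \<sigma> \<mu> b =
     measure (completion M)
       {\<omega> \<in> space M. (SUP t\<in>S. ereal (\<sigma> t * f t \<omega> + \<mu> t)) > ereal b}"

definition N0 :: "nat \<Rightarrow> real \<Rightarrow> real \<Rightarrow> real \<Rightarrow> real \<Rightarrow> real" where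
  "N0 d \<beta>s \<epsilon>0 \<epsilon> b =
     b powr (2 / \<beta>s * (3 * real d / \<beta>s + 2 + \<epsilon>0)) * \<epsilon> powr (- (2 / \<beta>s) - \<epsilon>0)"

text \<open>The supremum over \<open>t \<in> T\<close> of the distance from \<open>t\<close> to \<open>S\<close>, in the extended reals. For finite
  nonempty \<open>S\<close> the infimum is a minimum; for empty \<open>S\<close> (and nonempty \<open>T\<close>) the value is infinite,
  whereas \<open>infdist\<close> would give \<open>0\<close>.\<close>

definition covering_radius :: "'p::metric_space set \<Rightarrow> 'p set \<Rightarrow> ereal" where
  "covering_radius T S = (SUP t\<in>T. INF t'\<in>S. ereal (dist t t'))"

end

theory Submission
  imports Defs
begin

text \<open>
  Write \<open>X = \<sigma> f + \<mu>\<close>. The lattices \<open>T\<^sub>n\<close> with \<open>n = N 2^k\<close> are nested with dense union, so \<open>w - w\<^sub>N\<close> is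
  the sum over \<open>k\<close> of the increments of \<open>P(max X > b)\<close> from \<open>T\<^sub>n\<close> to \<open>T\<^bsub>2n\<^esub>\<close>. For a threshold \<open>\<eta>\<close> such an
  increment is at most \<open>P(b < max X \<le> b + \<eta>)\<close>, the maximum over \<open>T\<^bsub>2n\<^esub>\<close>, plus the sum over \<open>t \<in> T\<^bsub>2n\<^esub>\<close> of
  \<open>P(X t > b + \<eta>, X t' \<le> b)\<close>, where \<open>t' \<in> T\<^sub>n\<close> is near \<open>t\<close>.

  The first term is \<open>O(\<eta> b w)\<close>: cover \<open>T\<close> by finitely many balls on which \<open>f t = r(t, t\<^sub>0) f t\<^sub>0 + g t\<close> with
  \<open>r \<ge> 1/2\<close> and \<open>g\<close> independent of \<open>f t\<^sub>0\<close>. Given \<open>g\<close>, the event is that the standard normal variable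
  \<open>f t\<^sub>0\<close> lies in an interval \<open>(Y, Y + O(\<eta>)]\<close>, while exceedance of \<open>b\<close> is \<open>f t\<^sub>0 > Y\<close>; the two are compared by
  a tail estimate. The second term is bounded by a Chernoff estimate for the pair \<open>f t, f t'\<close>, which
  yields the tail of \<open>X t\<close> (at most \<open>O(b w)\<close>) times \<open>exp (- c \<eta>\<^sup>2 n^\<beta>\<^sup>*)\<close>; with \<open>\<eta> = n^-\<theta>\<close> and \<open>\<theta> < \<beta>\<^sup>*/2\<close>
  this beats the number of lattice points. The increments sum to \<open>O(b N^-\<theta> w)\<close>, and \<open>\<theta>\<close> close to
  \<open>\<beta>\<^sup>*/2\<close> makes this smaller than \<open>\<epsilon> w\<close>.
\<close>

section \<open>The standard normal distribution\<close>

lemma std_normal_interval_le: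
  assumes "L \<ge> 0" "c \<ge> 0" "\<And>y. x < y \<Longrightarrow> y \<le> x + L \<Longrightarrow> std_normal_density y \<le> c"
  shows "measure std_normal_distribution {x<..x+L} \<le> c * L"
proof -
  have "emeasure std_normal_distribution {x<..x+L}
      = (\<integral>\<^sup>+y. ennreal (std_normal_density y) * indicator {x<..x+L} y \<partial>lborel)"
    by (simp add: emeasure_density)
  also have "\<dots> \<le> (\<integral>\<^sup>+y. ennreal c * indicator {x<..x+L} y \<partial>lborel)"
    by (intro nn_integral_mono) (auto simp: indicator_def intro!: ennreal_leI assms)
  also have "\<dots> = ennreal (c * L)"
    using assms by (simp add: nn_integral_cmult ennreal_mult)
  finally show ?thesis
    using assms by (simp add: measure_def enn2real_leI)
qed

lemma std_normal_interval_ge: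
  assumes "L \<ge> 0" "c \<ge> 0" "\<And>y. x < y \<Longrightarrow> y \<le> x + L \<Longrightarrow> c \<le> std_normal_density y"
  shows "c * L \<le> measure std_normal_distribution {x<..x+L}"
proof -
  interpret N: real_distribution std_normal_distribution
    by (rule real_dist_normal_dist)
  have "ennreal (c * L) = (\<integral>\<^sup>+y. ennreal c * indicator {x<..x+L} y \<partial>lborel)"
    using assms by (simp add: nn_integral_cmult ennreal_mult)
  also have "\<dots> \<le> (\<integral>\<^sup>+y. ennreal (std_normal_density y) * indicator {x<..x+L} y \<partial>lborel)"
    by (intro nn_integral_mono) (auto simp: indicator_def intro!: ennreal_leI assms)
  also have "\<dots> = emeasure std_normal_distribution {x<..x+L}"
    by (simp add: emeasure_density)
  finally show ?thesis
    using N.emeasure_eq_measure by simp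
qed

lemma std_normal_density_antimono:
  assumes "\<bar>x\<bar> \<le> \<bar>y\<bar>"
  shows "std_normal_density y \<le> std_normal_density x"
proof -
  have "x\<^sup>2 \<le> y\<^sup>2" using assms by (simp add: abs_le_square_iff)
  then show ?thesis by (simp add: std_normal_density_def divide_right_mono)
qed

text \<open>On an interval of length \<open>1/R\<close> to the right of \<open>x\<close> the
  exponent \<open>y\<^sup>2 / 2\<close> grows by at most \<open>3/2\<close>, because
  \<open>x \<le> R\<close> and \<open>R \<ge> 1\<close>. So the tail contains a block of mass at
  least \<open>exp (-3/2) / R\<close> times the density at \<open>x\<close>.\<close>

lemma std_normal_tail_ge:
  assumes "0 \<le> x" "x \<le> R" "R \<ge> 1"
  shows "std_normal_density x \<le> exp (3/2) * R * measure std_normal_distribution {x<..}"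
proof -
  interpret N: real_distribution std_normal_distribution
    by (rule real_dist_normal_dist)
  let ?c = "exp (-3/2) * std_normal_density x"
  have "?c \<le> std_normal_density y" if y: "x < y" "y \<le> x + 1/R" for y
  proof -
    have "y\<^sup>2 \<le> (x + 1/R)\<^sup>2" using y assms by (intro power_mono) auto
    also have "\<dots> = x\<^sup>2 + 2 * (x / R) + (1/R)\<^sup>2" by (simp add: power2_eq_square algebra_simps add_divide_distrib)
    also have "\<dots> \<le> x\<^sup>2 + 2 * 1 + 1"
      using assms by (intro add_mono mult_left_mono) (auto simp: power_le_one divide_le_eq)
    finally have "exp (-3/2) * exp (- x\<^sup>2/2) \<le> exp (- y\<^sup>2 / 2)"
      by (simp flip: exp_add)
    then show ?thesis by (simp add: std_normal_density_def divide_right_mono)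
  qed
  then have "?c * (1/R) \<le> measure std_normal_distribution {x<..x+1/R}"
    using assms by (intro std_normal_interval_ge) auto
  also have "\<dots> \<le> measure std_normal_distribution {x<..}"
    by (intro N.finite_measure_mono) auto
  finally have "exp (3/2) * R * (?c * (1/R)) \<le> exp (3/2) * R * measure std_normal_distribution {x<..}"
    using assms by (intro mult_left_mono) auto
  moreover have "exp (3/2) * R * (?c * (1/R)) = std_normal_density x"
    using assms by (simp add: mult.assoc[symmetric] mult_exp_exp)
  ultimately show ?thesis by simp
qed

text \<open>The left endpoint will be random, so the bound has to hold for every real
  \<open>x\<close>. For \<open>x < 0\<close> the density is compared with its value at
  \<open>0\<close>; beyond \<open>R\<close> it is at most its value at \<open>R\<close>, which
  explains the additive term.\<close>

lemma std_normal_interval_le_tail: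
  assumes "R \<ge> 1" "L \<ge> 0"
  shows "measure std_normal_distribution {x<..x+L}
    \<le> L * (exp (3/2) * R * measure std_normal_distribution {x<..} + std_normal_density R)"
proof -
  interpret N: real_distribution std_normal_distribution
    by (rule real_dist_normal_dist)
  define x' where "x' = max 0 x"
  have "measure std_normal_distribution {x<..x+L} \<le> std_normal_density x' * L"
    using assms by (intro std_normal_interval_le std_normal_density_antimono) (auto simp: x'_def)
  also have "\<dots> \<le> (exp (3/2) * R * measure std_normal_distribution {x<..} + std_normal_density R) * L"
  proof (intro mult_right_mono)
    show "std_normal_density x' \<le> exp (3/2) * R * measure std_normal_distribution {x<..} + std_normal_density R"
    proof (cases "x' \<le> R")
      case True
      have "std_normal_density x' \<le> exp (3/2) * R * measure std_normal_distribution {x'<..}"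
        using True assms by (intro std_normal_tail_ge) (auto simp: x'_def)
      also have "\<dots> \<le> exp (3/2) * R * measure std_normal_distribution {x<..}"
        using assms by (intro mult_left_mono N.finite_measure_mono) (auto simp: x'_def)
      finally show ?thesis using normal_density_nonneg[of 0 1 R] by linarith
    next
      case False
      then have "std_normal_density x' \<le> std_normal_density R"
        using assms by (intro std_normal_density_antimono) auto
      moreover have "0 \<le> exp (3/2) * R * measure std_normal_distribution {x<..}" using assms by simp
      ultimately show ?thesis by linarith
    qed
  qed (use assms in auto)
  finally show ?thesis by (simp add: mult.commute)
qed

section \<open>Uniqueness of characteristic functions and independence\<close>

text \<open>Divided by their common total mass, which \<open>s = 0\<close> reveals, the weights
  become probability densities, and Levy's uniqueness theorem applies to the weighted laws. Mass
  zero is split off because it cannot be normalised.\<close>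

lemma weighted_char_unique:
  fixes X1 u1 :: "'a \<Rightarrow> real" and X2 u2 :: "'b \<Rightarrow> real"
  assumes "prob_space M1" "prob_space M2"
    and [measurable]: "X1 \<in> borel_measurable M1" "u1 \<in> borel_measurable M1"
      "X2 \<in> borel_measurable M2" "u2 \<in> borel_measurable M2"
    and b1: "\<And>\<omega>. 0 \<le> u1 \<omega>" "\<And>\<omega>. u1 \<omega> \<le> K"
    and b2: "\<And>\<omega>. 0 \<le> u2 \<omega>" "\<And>\<omega>. u2 \<omega> \<le> K"
    and eq: "\<And>s. (CLINT \<omega>|M1. u1 \<omega> *\<^sub>R iexp (s * X1 \<omega>)) = (CLINT \<omega>|M2. u2 \<omega> *\<^sub>R iexp (s * X2 \<omega>))"
    and [measurable]: "A \<in> sets borel"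
  shows "(LINT \<omega>|M1. u1 \<omega> * indicator A (X1 \<omega>)) = (LINT \<omega>|M2. u2 \<omega> * indicator A (X2 \<omega>))"
proof -
  interpret M1: prob_space M1 by fact
  interpret M2: prob_space M2 by fact
  have i1: "integrable M1 u1"
    by (rule M1.integrable_const_bound[where B=K]) (use b1 in auto)
  have i2: "integrable M2 u2"
    by (rule M2.integrable_const_bound[where B=K]) (use b2 in auto)
  define m where "m = (LINT \<omega>|M1. u1 \<omega>)"
  have "complex_of_real (LINT \<omega>|M1. u1 \<omega>) = complex_of_real (LINT \<omega>|M2. u2 \<omega>)"
    using eq[of 0] by (simp add: scaleR_conv_of_real)
  then have m2: "m = (LINT \<omega>|M2. u2 \<omega>)" by (simp add: m_def)
  have m0: "m \<ge> 0" unfolding m_def by (intro Bochner_Integration.integral_nonneg b1)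
  show ?thesis
  proof (cases "m = 0")
    case True
    have "AE \<omega> in M1. u1 \<omega> = 0"
      using True i1 b1 by (subst (asm) m_def) (simp add: integral_nonneg_eq_0_iff_AE)
    then have "(LINT \<omega>|M1. u1 \<omega> * indicator A (X1 \<omega>)) = (LINT \<omega>|M1. 0)"
      by (intro integral_cong_AE) auto
    moreover have "AE \<omega> in M2. u2 \<omega> = 0"
      using True i2 b2 by (subst (asm) m2) (simp add: integral_nonneg_eq_0_iff_AE)
    then have "(LINT \<omega>|M2. u2 \<omega> * indicator A (X2 \<omega>)) = (LINT \<omega>|M2. 0)"
      by (intro integral_cong_AE) auto
    ultimately show ?thesis by simp
  next
    case False
    with m0 have m: "m > 0" by simp
    define D1 where "D1 = density M1 (\<lambda>\<omega>. u1 \<omega> / m)"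
    define D2 where "D2 = density M2 (\<lambda>\<omega>. u2 \<omega> / m)"
    have p1: "prob_space D1"
      unfolding D1_def
    proof (rule prob_spaceI)
      show "emeasure (density M1 (\<lambda>\<omega>. ennreal (u1 \<omega> / m))) (space (density M1 (\<lambda>\<omega>. ennreal (u1 \<omega> / m)))) = 1"
        using b1 m i1 by (simp add: emeasure_density nn_integral_eq_integral)
          (simp add: m_def)
    qed
    have p2: "prob_space D2"
      unfolding D2_def
    proof (rule prob_spaceI)
      show "emeasure (density M2 (\<lambda>\<omega>. ennreal (u2 \<omega> / m))) (space (density M2 (\<lambda>\<omega>. ennreal (u2 \<omega> / m)))) = 1"
        using b2 m i2 by (simp add: emeasure_density nn_integral_eq_integral)
          (simp add: m2)
    qed
    have [measurable]: "X1 \<in> borel_measurable D1" "X2 \<in> borel_measurable D2"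
      by (simp_all add: D1_def D2_def)
    have L1: "integral\<^sup>L D1 g = (LINT \<omega>|M1. (u1 \<omega> / m) *\<^sub>R g \<omega>)"
      if "g \<in> borel_measurable M1" for g :: "'a \<Rightarrow> 'c :: {banach, second_countable_topology}"
      using that b1 m unfolding D1_def by (intro integral_density) auto
    have L2: "integral\<^sup>L D2 g = (LINT \<omega>|M2. (u2 \<omega> / m) *\<^sub>R g \<omega>)"
      if "g \<in> borel_measurable M2" for g :: "'b \<Rightarrow> 'c :: {banach, second_countable_topology}"
      using that b2 m unfolding D2_def by (intro integral_density) auto
    have "char (distr D1 borel X1) s = char (distr D2 borel X2) s" for s
    proof -
      have "char (distr D1 borel X1) s = (CLINT \<omega>|D1. iexp (s * X1 \<omega>))"
        by (simp add: char_def integral_distr)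
      also have "\<dots> = (CLINT \<omega>|M1. (1/m) *\<^sub>R (u1 \<omega> *\<^sub>R iexp (s * X1 \<omega>)))"
        by (subst L1) (auto simp: divide_simps)
      also have "\<dots> = (CLINT \<omega>|M2. (1/m) *\<^sub>R (u2 \<omega> *\<^sub>R iexp (s * X2 \<omega>)))"
        by (simp only: integral_scaleR_right eq)
      also have "\<dots> = (CLINT \<omega>|D2. iexp (s * X2 \<omega>))"
        by (subst L2) (auto simp: divide_simps)
      also have "\<dots> = char (distr D2 borel X2) s"
        by (simp add: char_def integral_distr)
      finally show ?thesis .
    qed
    then have "distr D1 borel X1 = distr D2 borel X2"
      by (intro Levy_uniqueness ext prob_space.real_distribution_distr p1 p2) auto
    moreover have "(LINT x|distr D1 borel X1. indicat_real A x) = (LINT \<omega>|D1. indicator A (X1 \<omega>))"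
      by (rule integral_distr) auto
    moreover have "(LINT x|distr D2 borel X2. indicat_real A x) = (LINT \<omega>|D2. indicator A (X2 \<omega>))"
      by (rule integral_distr) auto
    ultimately have "(LINT \<omega>|D1. indicat_real A (X1 \<omega>)) = (LINT \<omega>|D2. indicator A (X2 \<omega>))"
      by simp
    then show ?thesis
      using m by (simp add: L1 L2)
  qed
qed

text \<open>The coordinates are removed one at a time: testing against the weights \<open>1 + cos\<close> and \<open>1 + sin\<close> of a
  linear combination of the remaining coordinates reduces each step to the one-dimensional
  uniqueness theorem, and weights restricted to the event of the removed coordinate are again
  admissible.\<close>

lemma rectangle_unique:
  fixes X1 :: "'i \<Rightarrow> 'a \<Rightarrow> real" and X2 :: "'i \<Rightarrow> 'b \<Rightarrow> real"
  assumes "finite I" and ps: "prob_space M1" "prob_space M2"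
    and "\<And>i. i \<in> I \<Longrightarrow> X1 i \<in> borel_measurable M1" "\<And>i. i \<in> I \<Longrightarrow> X2 i \<in> borel_measurable M2"
    and "\<And>i. i \<in> I \<Longrightarrow> B i \<in> sets borel"
    and "u1 \<in> borel_measurable M1" "u2 \<in> borel_measurable M2"
    and "\<And>\<omega>. 0 \<le> u1 \<omega>" "\<And>\<omega>. u1 \<omega> \<le> K" "\<And>\<omega>. 0 \<le> u2 \<omega>" "\<And>\<omega>. u2 \<omega> \<le> (K::real)"
    and "\<And>c :: 'i \<Rightarrow> real. (CLINT \<omega>|M1. u1 \<omega> *\<^sub>R iexp (\<Sum>i\<in>I. c i * X1 i \<omega>))
           = (CLINT \<omega>|M2. u2 \<omega> *\<^sub>R iexp (\<Sum>i\<in>I. c i * X2 i \<omega>))"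
  shows "(LINT \<omega>|M1. u1 \<omega> * (\<Prod>i\<in>I. indicator (B i) (X1 i \<omega>)))
       = (LINT \<omega>|M2. u2 \<omega> * (\<Prod>i\<in>I. indicator (B i) (X2 i \<omega>)))"
  using assms(1,4-)
proof (induction I arbitrary: u1 u2 rule: finite_induct)
  case empty
  have "complex_of_real (LINT \<omega>|M1. u1 \<omega>) = complex_of_real (LINT \<omega>|M2. u2 \<omega>)"
    using empty.prems(10) by (simp add: scaleR_conv_of_real)
  then show ?case by simp
next
  case (insert j I)
  interpret M1: prob_space M1 by fact
  interpret M2: prob_space M2 by fact
  note [measurable] = insert.prems(4,5)
  have [measurable]: "X1 j \<in> borel_measurable M1" "X2 j \<in> borel_measurable M2" "B j \<in> sets borel"
    and mI [measurable]: "\<And>i. i \<in> I \<Longrightarrow> X1 i \<in> borel_measurable M1" "\<And>i. i \<in> I \<Longrightarrow> X2 i \<in> borel_measurable M2"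
    using insert.prems by auto
  note b1 = insert.prems(6,7) and b2 = insert.prems(8,9)
  define v1 where "v1 = (\<lambda>\<omega>. u1 \<omega> * indicator (B j) (X1 j \<omega>))"
  define v2 where "v2 = (\<lambda>\<omega>. u2 \<omega> * indicator (B j) (X2 j \<omega>))"
  have [measurable]: "v1 \<in> borel_measurable M1" "v2 \<in> borel_measurable M2"
    by (simp_all add: v1_def v2_def)
  have vb1: "0 \<le> v1 \<omega>" "v1 \<omega> \<le> K" and ub1: "\<bar>u1 \<omega>\<bar> \<le> K" for \<omega>
    using b1[of \<omega>] by (auto simp: v1_def indicator_def)
  have vb2: "0 \<le> v2 \<omega>" "v2 \<omega> \<le> K" and ub2: "\<bar>u2 \<omega>\<bar> \<le> K" for \<omega>
    using b2[of \<omega>] by (auto simp: v2_def indicator_def)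
  have K0: "K \<ge> 0" using b1[of undefined] by linarith
  have "(LINT \<omega>|M1. v1 \<omega> * (\<Prod>i\<in>I. indicator (B i) (X1 i \<omega>)))
       = (LINT \<omega>|M2. v2 \<omega> * (\<Prod>i\<in>I. indicator (B i) (X2 i \<omega>)))"
  proof (rule insert.IH)
    fix c :: "'i \<Rightarrow> real"
    define G1 where "G1 = (\<lambda>\<omega>. \<Sum>i\<in>I. c i * X1 i \<omega>)"
    define G2 where "G2 = (\<lambda>\<omega>. \<Sum>i\<in>I. c i * X2 i \<omega>)"
    have [measurable]: "G1 \<in> borel_measurable M1" "G2 \<in> borel_measurable M2"
      unfolding G1_def G2_def by measurable
    have base: "(CLINT \<omega>|M1. u1 \<omega> *\<^sub>R iexp (s * X1 j \<omega> + r * G1 \<omega>))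
        = (CLINT \<omega>|M2. u2 \<omega> *\<^sub>R iexp (s * X2 j \<omega> + r * G2 \<omega>))" for s r
    proof -
      let ?c = "\<lambda>i. if i = j then s else r * c i"
      have "(\<Sum>i\<in>insert j I. ?c i * x i) = s * x j + r * (\<Sum>i\<in>I. c i * x i)" for x
        using insert.hyps by (simp add: sum_distrib_left mult.assoc) (intro sum.cong; auto)
      then show ?thesis
        using insert.prems(10)[of ?c] by (simp add: G1_def G2_def)
    qed
    \<comment> \<open>\<open>cos\<close> and \<open>sin\<close> are combinations of
      \<open>iexp x\<close> and \<open>iexp (- x)\<close>, so a weight \<open>1 + h\<close> of
      \<open>G1\<close> or \<open>G2\<close> only needs \<open>base\<close> at \<open>r = 0\<close>,
      \<open>1\<close> and \<open>-1\<close>.\<close>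
    have weight: "(LINT \<omega>|M1. v1 \<omega> * h (G1 \<omega>)) = (LINT \<omega>|M2. v2 \<omega> * h (G2 \<omega>))"
      if [measurable]: "h \<in> borel_measurable borel" and hb: "\<And>x. \<bar>h x\<bar> \<le> 1"
        and h: "\<And>x. complex_of_real (h x) = a * iexp x + b * iexp (- x)" for h :: "real \<Rightarrow> real" and a b
    proof -
      define F1 where "F1 = (\<lambda>s r \<omega>. u1 \<omega> *\<^sub>R iexp (s * X1 j \<omega> + r * G1 \<omega>))"
      define F2 where "F2 = (\<lambda>s r \<omega>. u2 \<omega> *\<^sub>R iexp (s * X2 j \<omega> + r * G2 \<omega>))"
      have int1: "integrable M1 (F1 s r)" for s r
        unfolding F1_def by (rule M1.integrable_const_bound[where B=K]) (use ub1 in auto)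
      have int2: "integrable M2 (F2 s r)" for s r
        unfolding F2_def by (rule M2.integrable_const_bound[where B=K]) (use ub2 in auto)
      have F: "(CLINT \<omega>|M1. F1 s r \<omega>) = (CLINT \<omega>|M2. F2 s r \<omega>)" for s r
        unfolding F1_def F2_def by (rule base)
      have expand: "(w * (1 + h y)) *\<^sub>R iexp x = w *\<^sub>R iexp (x + 0 * y)
          + a * (w *\<^sub>R iexp (x + 1 * y)) + b * (w *\<^sub>R iexp (x + (-1) * y))" for w x y
      proof -
        have "iexp (x + y) = iexp x * iexp y" "iexp (x - y) = iexp x * iexp (- y)"
          by (simp_all add: exp_add[symmetric] distrib_left right_diff_distrib)
        then have "w *\<^sub>R iexp (x + 0 * y) + a * (w *\<^sub>R iexp (x + 1 * y)) + b * (w *\<^sub>R iexp (x + (-1) * y))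
            = complex_of_real w * iexp x * (1 + (a * iexp y + b * iexp (- y)))"
          by (simp only: scaleR_conv_of_real mult_zero_left mult_1_left mult_minus1 add_0_right diff_conv_add_uminus[symmetric])
            (simp only: distrib_left mult_1_left mult_1_right mult_ac add_ac)
        then show ?thesis
          unfolding h[symmetric] by (simp only: scaleR_conv_of_real of_real_mult of_real_add of_real_1 mult_ac)
      qed
      have "(u1 \<omega> * (1 + h (G1 \<omega>))) *\<^sub>R iexp (s * X1 j \<omega>)
          = F1 s 0 \<omega> + a * F1 s 1 \<omega> + b * F1 s (-1) \<omega>"
        "(u2 \<omega>' * (1 + h (G2 \<omega>'))) *\<^sub>R iexp (s * X2 j \<omega>')
          = F2 s 0 \<omega>' + a * F2 s 1 \<omega>' + b * F2 s (-1) \<omega>'" for s \<omega> \<omega>'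
        unfolding F1_def F2_def by (rule expand)+
      then have full: "(CLINT \<omega>|M1. (u1 \<omega> * (1 + h (G1 \<omega>))) *\<^sub>R iexp (s * X1 j \<omega>))
          = (CLINT \<omega>|M2. (u2 \<omega> * (1 + h (G2 \<omega>))) *\<^sub>R iexp (s * X2 j \<omega>))" for s
        using int1 int2 F by simp
      have p: "0 \<le> 1 + h x" "1 + h x \<le> 2" for x using hb[of x] by auto
      \<comment> \<open>Adding \<open>1\<close> keeps the weights nonnegative. The identity for
        \<open>u1\<close> and \<open>u2\<close> alone is subtracted afterwards, which leaves the
        signed test function \<open>h\<close>.\<close>
      have "(LINT \<omega>|M1. (u1 \<omega> * (1 + h (G1 \<omega>))) * indicator (B j) (X1 j \<omega>))
          = (LINT \<omega>|M2. (u2 \<omega> * (1 + h (G2 \<omega>))) * indicator (B j) (X2 j \<omega>))"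
        by (rule weighted_char_unique[OF ps, where K="K * 2"])
          (use full b1 b2 p K0 in \<open>auto intro!: mult_mono\<close>)
      moreover have "(LINT \<omega>|M1. u1 \<omega> * indicator (B j) (X1 j \<omega>))
          = (LINT \<omega>|M2. u2 \<omega> * indicator (B j) (X2 j \<omega>))"
        by (rule weighted_char_unique[OF ps, where K="K"])
          (use base[of _ 0] b1 b2 p in \<open>auto intro!: mult_mono\<close>)
      moreover have "(LINT \<omega>|M1. (u1 \<omega> * (1 + h (G1 \<omega>))) * indicator (B j) (X1 j \<omega>))
          = (LINT \<omega>|M1. u1 \<omega> * indicator (B j) (X1 j \<omega>)) + (LINT \<omega>|M1. v1 \<omega> * h (G1 \<omega>))"
      proof (subst Bochner_Integration.integral_add[symmetric])
        show "integrable M1 (\<lambda>\<omega>. u1 \<omega> * indicator (B j) (X1 j \<omega>))"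
          by (rule M1.integrable_const_bound[where B=K]) (use vb1 in \<open>auto simp: v1_def\<close>)
        show "integrable M1 (\<lambda>\<omega>. v1 \<omega> * h (G1 \<omega>))"
        proof (rule M1.integrable_const_bound[where B="K * 1"])
          show "AE \<omega> in M1. norm (v1 \<omega> * h (G1 \<omega>)) \<le> K * 1"
            unfolding real_norm_def abs_mult using vb1 hb K0 by (intro AE_I2 mult_mono) auto
        qed simp
      qed (auto simp: v1_def algebra_simps)
      moreover have "(LINT \<omega>|M2. (u2 \<omega> * (1 + h (G2 \<omega>))) * indicator (B j) (X2 j \<omega>))
          = (LINT \<omega>|M2. u2 \<omega> * indicator (B j) (X2 j \<omega>)) + (LINT \<omega>|M2. v2 \<omega> * h (G2 \<omega>))"
      proof (subst Bochner_Integration.integral_add[symmetric])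
        show "integrable M2 (\<lambda>\<omega>. u2 \<omega> * indicator (B j) (X2 j \<omega>))"
          by (rule M2.integrable_const_bound[where B=K]) (use vb2 in \<open>auto simp: v2_def\<close>)
        show "integrable M2 (\<lambda>\<omega>. v2 \<omega> * h (G2 \<omega>))"
        proof (rule M2.integrable_const_bound[where B="K * 1"])
          show "AE \<omega> in M2. norm (v2 \<omega> * h (G2 \<omega>)) \<le> K * 1"
            unfolding real_norm_def abs_mult using vb2 hb K0 by (intro AE_I2 mult_mono) auto
        qed simp
      qed (auto simp: v2_def algebra_simps)
      ultimately show ?thesis by simp
    qed
    have c: "(LINT \<omega>|M1. v1 \<omega> * cos (G1 \<omega>)) = (LINT \<omega>|M2. v2 \<omega> * cos (G2 \<omega>))"
      by (rule weight[of cos "1/2" "1/2"]) (auto simp: complex_eq_iff Re_exp Im_exp)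
    have s: "(LINT \<omega>|M1. v1 \<omega> * sin (G1 \<omega>)) = (LINT \<omega>|M2. v2 \<omega> * sin (G2 \<omega>))"
      by (rule weight[of sin "-\<i>/2" "\<i>/2"]) (auto simp: complex_eq_iff Re_exp Im_exp)
    have i1: "integrable M1 (\<lambda>\<omega>. v1 \<omega> *\<^sub>R iexp (G1 \<omega>))"
      by (rule M1.integrable_const_bound[where B=K]) (use vb1 in auto)
    have i2: "integrable M2 (\<lambda>\<omega>. v2 \<omega> *\<^sub>R iexp (G2 \<omega>))"
      by (rule M2.integrable_const_bound[where B=K]) (use vb2 in auto)
    have "(CLINT \<omega>|M1. v1 \<omega> *\<^sub>R iexp (G1 \<omega>)) = (CLINT \<omega>|M2. v2 \<omega> *\<^sub>R iexp (G2 \<omega>))"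
      using c s
      by (intro complex_eqI) (simp_all flip: integral_Re[OF i1] integral_Re[OF i2] integral_Im[OF i1] integral_Im[OF i2] add: Re_exp Im_exp)
    then show "(CLINT \<omega>|M1. v1 \<omega> *\<^sub>R iexp (\<Sum>i\<in>I. c i * X1 i \<omega>)) = (CLINT \<omega>|M2. v2 \<omega> *\<^sub>R iexp (\<Sum>i\<in>I. c i * X2 i \<omega>))"
      by (simp add: G1_def G2_def)
  qed (use vb1 vb2 insert.prems in auto)
  then show ?case
    using insert.hyps by (simp add: v1_def v2_def mult.assoc)
qed

text \<open>Independence is read as agreement with a model on \<open>M \<Otimes>\<^sub>M M\<close>
  in which \<open>Z\<close> lives on the first factor and the family on the second. The factorised
  characteristic function says that both models agree on all linear combinations, and
  \<open>rectangle_unique\<close> with weight \<open>1\<close> passes to rectangles.\<close>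

lemma (in prob_space) indep_rectangles:
  fixes Z :: "'a \<Rightarrow> real" and X :: "'i \<Rightarrow> 'a \<Rightarrow> real"
  assumes "finite I" and [measurable]: "Z \<in> borel_measurable M"
    and mX [measurable]: "\<And>i. i \<in> I \<Longrightarrow> X i \<in> borel_measurable M"
    and [measurable]: "A \<in> sets borel" and mB [measurable]: "\<And>i. i \<in> I \<Longrightarrow> B i \<in> sets borel"
    and ch: "\<And>s (c :: 'i \<Rightarrow> real). (CLINT \<omega>|M. iexp (s * Z \<omega> + (\<Sum>i\<in>I. c i * X i \<omega>)))
      = (CLINT \<omega>|M. iexp (s * Z \<omega>)) * (CLINT \<omega>|M. iexp (\<Sum>i\<in>I. c i * X i \<omega>))"
  shows "prob {\<omega>\<in>space M. Z \<omega> \<in> A \<and> (\<forall>i\<in>I. X i \<omega> \<in> B i)}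
    = prob {\<omega>\<in>space M. Z \<omega> \<in> A} * prob {\<omega>\<in>space M. \<forall>i\<in>I. X i \<omega> \<in> B i}"
proof -
  interpret P: pair_prob_space M M ..
  let ?P = "M \<Otimes>\<^sub>M M"
  let ?J = "insert None (Some ` I)"
  \<comment> \<open>\<open>None\<close> indexes \<open>Z\<close> and \<open>Some i\<close> indexes
    \<open>X i\<close>, so that a single finite family covers both.\<close>
  define X1 where "X1 = (\<lambda>j \<omega>. case j of None \<Rightarrow> Z \<omega> | Some i \<Rightarrow> X i \<omega>)"
  define X2 where "X2 = (\<lambda>j (\<omega>, \<omega>'). case j of None \<Rightarrow> Z \<omega> | Some i \<Rightarrow> X i \<omega>')"
  define C where "C = (\<lambda>j. case j of None \<Rightarrow> A | Some i \<Rightarrow> B i)"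
  have sum1: "(\<Sum>j\<in>?J. c j * X1 j \<omega>) = c None * Z \<omega> + (\<Sum>i\<in>I. c (Some i) * X i \<omega>)" for c \<omega>
    using \<open>finite I\<close> by (simp add: X1_def sum.reindex)
  have sum2: "(\<Sum>j\<in>?J. c j * X2 j (\<omega>, \<omega>')) = c None * Z \<omega> + (\<Sum>i\<in>I. c (Some i) * X i \<omega>')" for c \<omega> \<omega>'
    using \<open>finite I\<close> by (simp add: X2_def sum.reindex)
  have fub: "(CLINT \<omega>|?P. (case \<omega> of (x, y) \<Rightarrow> g x * h y)) = (CLINT \<omega>|M. g \<omega>) * (CLINT \<omega>|M. h \<omega>)"
    if "g \<in> borel_measurable M" "h \<in> borel_measurable M" "\<And>x. norm (g x) \<le> 1" "\<And>x. norm (h x) \<le> 1" for g h :: "'a \<Rightarrow> complex"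
  proof -
    note [measurable] = that(1,2)
    have "integrable ?P (\<lambda>\<omega>. case \<omega> of (x, y) \<Rightarrow> g x * h y)"
      by (rule P.P.integrable_const_bound[where B=1])
        (use that in \<open>auto simp: norm_mult split_beta' intro!: AE_I2 mult_le_one\<close>)
    from P.integral_fst'[OF this] show ?thesis by simp
  qed
  have "(LINT \<omega>|M. 1 * (\<Prod>j\<in>?J. indicat_real (C j) (X1 j \<omega>)))
      = (LINT \<omega>|?P. 1 * (\<Prod>j\<in>?J. indicat_real (C j) (X2 j \<omega>)))"
  proof (rule rectangle_unique[where K=1])
    fix c :: "'i option \<Rightarrow> real"
    have "(CLINT \<omega>|?P. iexp (\<Sum>j\<in>?J. c j * X2 j \<omega>))
      = (CLINT \<omega>|?P. (case \<omega> of (x, y) \<Rightarrow> iexp (c None * Z x) * iexp (\<Sum>i\<in>I. c (Some i) * X i y)))"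
      by (rule Bochner_Integration.integral_cong) (auto simp only: split_paired_all prod.case sum2 of_real_add distrib_left exp_add)
    also have "\<dots> = (CLINT \<omega>|M. iexp (c None * Z \<omega>)) * (CLINT \<omega>|M. iexp (\<Sum>i\<in>I. c (Some i) * X i \<omega>))"
      by (rule fub) auto
    finally show "(CLINT \<omega>|M. 1 *\<^sub>R iexp (\<Sum>j\<in>?J. c j * X1 j \<omega>)) = (CLINT \<omega>|?P. 1 *\<^sub>R iexp (\<Sum>j\<in>?J. c j * X2 j \<omega>))"
      using ch[of "c None" "\<lambda>i. c (Some i)"] by (simp only: sum1 scaleR_one)
  qed (use assms in \<open>auto simp: X1_def X2_def C_def prob_space_axioms P.prob_space_axioms split_beta'\<close>)
  moreover have "(LINT \<omega>|M. 1 * (\<Prod>j\<in>?J. indicat_real (C j) (X1 j \<omega>)))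
      = (LINT \<omega>|M. indicator {\<omega>\<in>space M. Z \<omega> \<in> A \<and> (\<forall>i\<in>I. X i \<omega> \<in> B i)} \<omega>)"
    using \<open>finite I\<close> by (intro Bochner_Integration.integral_cong)
      (auto simp: C_def prod.reindex prod.insert_if X1_def indicator_def)
  moreover have "(LINT \<omega>|?P. 1 * (\<Prod>j\<in>?J. indicat_real (C j) (X2 j \<omega>)))
      = (LINT \<omega>|?P. indicator ({\<omega>\<in>space M. Z \<omega> \<in> A} \<times> {\<omega>\<in>space M. \<forall>i\<in>I. X i \<omega> \<in> B i}) \<omega>)"
    using \<open>finite I\<close> by (intro Bochner_Integration.integral_cong)
      (auto simp: C_def prod.reindex prod.insert_if X2_def indicator_def space_pair_measure)
  moreover have "{\<omega>\<in>space M. \<forall>i\<in>I. X i \<omega> \<in> B i} \<in> events"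
    "{\<omega>\<in>space M. Z \<omega> \<in> A \<and> (\<forall>i\<in>I. X i \<omega> \<in> B i)} \<in> events"
    using \<open>finite I\<close> by measurable
  ultimately show ?thesis
    by (simp add: emeasure_pair_measure_Times measure_def enn2real_mult)
qed

section \<open>Gaussian random variables\<close>

lemma (in prob_space) gaussian_rv_measurable:
  "gaussian_rv M X \<Longrightarrow> X \<in> borel_measurable M"
  unfolding gaussian_rv_def distributed_def by auto

lemma (in prob_space) gaussian_rv_integrable_sq:
  assumes "gaussian_rv M X"
  shows "integrable M (\<lambda>\<omega>. (X \<omega>)\<^sup>2)"
  using assms unfolding gaussian_rv_def
proof (elim disjE exE conjE)
  fix m s :: real assume s: "s > 0" and D: "distributed M lborel X (normal_density m s)"
  \<comment> \<open>The second moment about zero is assembled from the central one and the mean: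
    \<open>x\<^sup>2 = (x - m)\<^sup>2 + 2 * m * x - m\<^sup>2\<close>.\<close>
  have "integrable lborel (\<lambda>x. normal_density m s x * (x - m)^2 + 2 * m * (normal_density m s x * x) - m\<^sup>2 * normal_density m s x)"
    using s by (intro Bochner_Integration.integrable_add Bochner_Integration.integrable_diff integrable_mult_right
      integrable_normal_moment integrable_normal_moment_nz_1 integrable_normal_density)
  then have "integrable lborel (\<lambda>x. normal_density m s x * x\<^sup>2)"
    by (simp add: power2_eq_square algebra_simps)
  then show ?thesis
    by (subst (asm) distributed_integrable[OF D]) auto
next
  fix c assume [measurable]: "X \<in> borel_measurable M" and "AE \<omega> in M. X \<omega> = c"
  then have "integrable M (\<lambda>\<omega>. (X \<omega>)\<^sup>2) \<longleftrightarrow> integrable M (\<lambda>\<omega>. c\<^sup>2)"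
    by (intro integrable_cong_AE) auto
  then show ?thesis by simp
qed

text \<open>Constants count as Gaussian, so a degenerate case accompanies the case with a density;
  centering forces the mean or the constant to vanish.\<close>

lemma (in prob_space) gaussian_rv_centered_cases:
  assumes "gaussian_rv M X" "expectation X = 0"
  obtains s where "s > 0" "distributed M lborel X (normal_density 0 s)" "expectation (\<lambda>\<omega>. (X \<omega>)\<^sup>2) = s\<^sup>2"
  | "X \<in> borel_measurable M" "AE \<omega> in M. X \<omega> = 0" "expectation (\<lambda>\<omega>. (X \<omega>)\<^sup>2) = 0"
  using assms(1) unfolding gaussian_rv_def
proof (elim disjE exE conjE)
  fix m s :: real assume s: "s > 0" and D: "distributed M lborel X (normal_density m s)"
  have "m = 0" using normal_distributed_expectation[OF s D] assms(2) by simp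
  moreover have "variance X = s\<^sup>2" by (rule normal_distributed_variance[OF s D])
  ultimately show thesis using that(1) s D assms(2) by simp
next
  fix c assume [measurable]: "X \<in> borel_measurable M" and c: "AE \<omega> in M. X \<omega> = c"
  have "expectation X = expectation (\<lambda>_. c)" using c by (intro integral_cong_AE) auto
  with assms(2) have "c = 0" by (simp add: prob_space)
  with c have z: "AE \<omega> in M. X \<omega> = 0" by simp
  then have "expectation (\<lambda>\<omega>. (X \<omega>)\<^sup>2) = expectation (\<lambda>_. 0)" by (intro integral_cong_AE) auto
  with z show thesis using that(2) by simp
qed

lemma (in prob_space) gaussian_rv_char:
  assumes "gaussian_rv M X" "expectation X = 0"
  shows "(CLINT \<omega>|M. iexp (X \<omega>)) = exp (- expectation (\<lambda>\<omega>. (X \<omega>)\<^sup>2) / 2)"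
  using assms
proof (cases rule: gaussian_rv_centered_cases)
  case (1 s)
  have X [measurable]: "X \<in> borel_measurable M" using assms by (simp add: gaussian_rv_measurable)
  have "distributed M lborel (\<lambda>\<omega>. (X \<omega> - 0) / s) std_normal_density"
    using 1 by (subst normal_standard_normal_convert[symmetric]) auto
  then have "distr M lborel (\<lambda>\<omega>. X \<omega> / s) = std_normal_distribution"
    by (simp add: distributed_distr_eq_density)
  then have "(CLINT x|distr M lborel (\<lambda>\<omega>. X \<omega> / s). iexp (s * x)) = exp (- s\<^sup>2 / 2)"
    using char_std_normal_distribution by (simp add: char_def fun_eq_iff)
  then show ?thesis
    using 1 by (subst (asm) integral_distr) auto
next
  case 2
  have "(CLINT \<omega>|M. iexp (X \<omega>)) = (CLINT \<omega>|M. 1)"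
    using 2 by (intro integral_cong_AE) auto
  then show ?thesis using 2 by (simp add: prob_space)
qed

lemma (in prob_space) gaussian_rv_exp_moment:
  assumes "gaussian_rv M X" "expectation X = 0"
  shows "(\<integral>\<^sup>+\<omega>. ennreal (exp (X \<omega>)) \<partial>M) = ennreal (exp (expectation (\<lambda>\<omega>. (X \<omega>)\<^sup>2) / 2))"
  using assms
proof (cases rule: gaussian_rv_centered_cases)
  case (1 s)
  \<comment> \<open>Completing the square: the factor \<open>exp x\<close> shifts the mean to
    \<open>s\<^sup>2\<close>, and the shifted density integrates to one.\<close>
  have "normal_density 0 s x * exp x = exp (s\<^sup>2 / 2) * normal_density (s\<^sup>2) s x" for x
  proof -
    have "- x\<^sup>2 / (2 * s\<^sup>2) + x = s\<^sup>2 / 2 + - (x - s\<^sup>2)\<^sup>2 / (2 * s\<^sup>2)"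
      using 1 by (simp add: field_simps power2_eq_square)
    then show ?thesis
      by (simp add: normal_density_def mult_exp_exp ac_simps)
  qed
  then have "(\<integral>\<^sup>+x. ennreal (normal_density 0 s x) * ennreal (exp x) \<partial>lborel)
      = (\<integral>\<^sup>+x. ennreal (exp (s\<^sup>2 / 2)) * ennreal (normal_density (s\<^sup>2) s x) \<partial>lborel)"
    by (simp flip: ennreal_mult)
  also have "\<dots> = ennreal (exp (s\<^sup>2 / 2)) * ennreal 1"
    using 1 by (subst nn_integral_cmult) (simp_all add: nn_integral_eq_integral)
  finally have "(\<integral>\<^sup>+x. ennreal (normal_density 0 s x) * ennreal (exp x) \<partial>lborel) = exp (s\<^sup>2 / 2)"
    by simp
  then show ?thesis
    using distributed_nn_integral[OF 1(2), of "\<lambda>x. ennreal (exp x)"] 1(3) by simp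
next
  case 2
  have "(\<integral>\<^sup>+\<omega>. ennreal (exp (X \<omega>)) \<partial>M) = (\<integral>\<^sup>+\<omega>. 1 \<partial>M)"
    using 2 by (intro nn_integral_cong_AE) auto
  then show ?thesis using 2 by (simp add: emeasure_space_1)
qed

lemma (in prob_space) gaussian_rv_standard:
  assumes "gaussian_rv M X" "expectation X = 0" "expectation (\<lambda>\<omega>. (X \<omega>)\<^sup>2) = 1"
  shows "distr M borel X = std_normal_distribution"
  using assms(1,2)
proof (cases rule: gaussian_rv_centered_cases)
  case (1 s)
  then have "s = 1" using assms(3) by (simp add: power2_eq_1_iff)
  then show ?thesis
    using 1 by (simp add: distributed_distr_eq_density[symmetric] cong: distr_cong)
next
  case 2
  then show ?thesis using assms(3) by simp
qed

section \<open>Gaussian fields\<close>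

locale gaussian_field = prob_space M for M :: "'w measure" +
  fixes T :: "'p set" and f :: "'p \<Rightarrow> 'w \<Rightarrow> real"
  assumes field: "std_gaussian_field M T f"
begin

text \<open>The linear span of the field. It is closed under linear combinations and all its members
  are centered Gaussian, so statements on joint laws reduce to second moments of single
  members.\<close>

definition lin :: "('w \<Rightarrow> real) set" where
  "lin = {X. \<exists>S a. finite S \<and> S \<subseteq> T \<and> X = (\<lambda>\<omega>. \<Sum>t\<in>S. a t * f t \<omega>)}"

lemma lin_gaussian: "X \<in> lin \<Longrightarrow> gaussian_rv M X"
  using field unfolding lin_def std_gaussian_field_def multivariate_gaussian_def by auto

lemma lin_measurable: "X \<in> lin \<Longrightarrow> X \<in> borel_measurable M"
  by (intro gaussian_rv_measurable lin_gaussian)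

lemma lin_integrable_sq: "X \<in> lin \<Longrightarrow> integrable M (\<lambda>\<omega>. (X \<omega>)\<^sup>2)"
  by (intro gaussian_rv_integrable_sq lin_gaussian)

lemma lin_f: "t \<in> T \<Longrightarrow> f t \<in> lin"
  unfolding lin_def by (auto intro!: exI[of _ "{t}"] exI[of _ "\<lambda>_. 1"])

lemma lin_scale: "X \<in> lin \<Longrightarrow> (\<lambda>\<omega>. c * X \<omega>) \<in> lin"
  unfolding lin_def
  by clarify (rule exI, rule exI[of _ "\<lambda>t. c * _ t"], auto simp: sum_distrib_left mult.assoc)

lemma lin_add: "(\<lambda>\<omega>. X \<omega> + Y \<omega>) \<in> lin" if X: "X \<in> lin" and Y: "Y \<in> lin"
proof -
  obtain S a where S: "finite S" "S \<subseteq> T" "X = (\<lambda>\<omega>. \<Sum>t\<in>S. a t * f t \<omega>)"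
    using X unfolding lin_def by auto
  obtain S' a' where S': "finite S'" "S' \<subseteq> T" "Y = (\<lambda>\<omega>. \<Sum>t\<in>S'. a' t * f t \<omega>)"
    using Y unfolding lin_def by auto
  let ?a = "\<lambda>t. (if t \<in> S then a t else 0) + (if t \<in> S' then a' t else 0)"
  have "X \<omega> + Y \<omega> = (\<Sum>t\<in>S \<union> S'. ?a t * f t \<omega>)" for \<omega>
  proof -
    have "(\<Sum>t\<in>S \<union> S'. (if t \<in> S then a t else 0) * f t \<omega>) = X \<omega>"
      using S S' by (auto intro!: sum.mono_neutral_cong_right)
    moreover have "(\<Sum>t\<in>S \<union> S'. (if t \<in> S' then a' t else 0) * f t \<omega>) = Y \<omega>"
      using S S' by (auto intro!: sum.mono_neutral_cong_right)
    ultimately show ?thesis by (simp add: distrib_right sum.distrib)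
  qed
  then show ?thesis
    unfolding lin_def using S S' by (intro CollectI exI[of _ "S \<union> S'"] exI[of _ ?a]) auto
qed

lemma lin_sum: "finite I \<Longrightarrow> (\<And>i. i \<in> I \<Longrightarrow> X i \<in> lin) \<Longrightarrow> (\<lambda>\<omega>. \<Sum>i\<in>I. c i * X i \<omega>) \<in> lin"
proof (induction I rule: finite_induct)
  case empty
  then show ?case unfolding lin_def by (auto intro!: exI[of _ "{}"])
next
  case (insert i I)
  then show ?case by (auto intro!: lin_add lin_scale)
qed

lemma lin_integrable_prod:
  assumes "X \<in> lin" "Y \<in> lin"
  shows "integrable M (\<lambda>\<omega>. X \<omega> * Y \<omega>)"
proof -
  \<comment> \<open>Polarisation reduces the product to squares.\<close>
  have "integrable M (\<lambda>\<omega>. ((X \<omega> + Y \<omega>)\<^sup>2 - (X \<omega>)\<^sup>2 - (Y \<omega>)\<^sup>2) / 2)"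
    using assms by (intro integrable_divide Bochner_Integration.integrable_diff lin_integrable_sq lin_add)
  then show ?thesis by (simp add: power2_eq_square algebra_simps)
qed

lemma lin_integrable: "X \<in> lin \<Longrightarrow> integrable M X"
  by (rule square_integrable_imp_integrable) (auto intro: lin_measurable lin_integrable_sq)

lemma lin_expectation: "X \<in> lin \<Longrightarrow> expectation X = 0"
proof -
  assume "X \<in> lin"
  then obtain S a where S: "finite S" "S \<subseteq> T" "X = (\<lambda>\<omega>. \<Sum>t\<in>S. a t * f t \<omega>)"
    unfolding lin_def by auto
  have "expectation X = (\<Sum>t\<in>S. a t * expectation (f t))"
    unfolding S(3) using S lin_integrable[OF lin_f]
    by (subst Bochner_Integration.integral_sum) auto
  also have "\<dots> = 0"
    using S field unfolding std_gaussian_field_def by (intro sum.neutral) auto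
  finally show ?thesis .
qed

abbreviation r :: "'p \<Rightarrow> 'p \<Rightarrow> real" where "r \<equiv> correlation_fun M f"

lemma r_commute: "r s t = r t s"
  by (simp add: correlation_fun_def mult.commute)

lemma r_same: "t \<in> T \<Longrightarrow> r t t = 1"
  using field lin_expectation[OF lin_f]
  by (auto simp: std_gaussian_field_def correlation_fun_def power2_eq_square)

lemma expectation_f_sq: "t \<in> T \<Longrightarrow> expectation (\<lambda>\<omega>. (f t \<omega>)\<^sup>2) = 1"
  using r_same by (simp add: correlation_fun_def power2_eq_square)

lemma distr_f: "t \<in> T \<Longrightarrow> distr M borel (f t) = std_normal_distribution"
  by (intro gaussian_rv_standard lin_gaussian lin_f lin_expectation expectation_f_sq)

lemma lin_expectation_add_sq:
  assumes "X \<in> lin" "Y \<in> lin"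
  shows "expectation (\<lambda>\<omega>. (a * X \<omega> + b * Y \<omega>)\<^sup>2) = a\<^sup>2 * expectation (\<lambda>\<omega>. (X \<omega>)\<^sup>2)
    + 2 * a * b * expectation (\<lambda>\<omega>. X \<omega> * Y \<omega>) + b\<^sup>2 * expectation (\<lambda>\<omega>. (Y \<omega>)\<^sup>2)"
proof -
  have "expectation (\<lambda>\<omega>. (a * X \<omega> + b * Y \<omega>)\<^sup>2)
      = expectation (\<lambda>\<omega>. a\<^sup>2 * (X \<omega>)\<^sup>2 + 2 * a * b * (X \<omega> * Y \<omega>) + b\<^sup>2 * (Y \<omega>)\<^sup>2)"
    by (rule Bochner_Integration.integral_cong) (auto simp: power2_eq_square algebra_simps)
  then show ?thesis
    using lin_integrable_sq lin_integrable_prod assms by simp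
qed

lemma lin_char:
  "X \<in> lin \<Longrightarrow> (CLINT \<omega>|M. iexp (X \<omega>)) = exp (- expectation (\<lambda>\<omega>. (X \<omega>)\<^sup>2) / 2)"
  by (intro gaussian_rv_char lin_gaussian lin_expectation)

text \<open>The exponential Markov inequality with parameter one; other parameters are covered
  because \<open>lin\<close> is closed under scaling.\<close>

lemma lin_chernoff:
  assumes "X \<in> lin"
  shows "prob {\<omega>\<in>space M. c \<le> X \<omega>} \<le> exp (expectation (\<lambda>\<omega>. (X \<omega>)\<^sup>2) / 2 - c)"
proof -
  have [measurable]: "X \<in> borel_measurable M" by (intro lin_measurable assms)
  have "emeasure M {\<omega>\<in>space M. c \<le> X \<omega>} = (\<integral>\<^sup>+\<omega>. indicator {\<omega>\<in>space M. c \<le> X \<omega>} \<omega> \<partial>M)"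
    by simp
  also have "\<dots> \<le> (\<integral>\<^sup>+\<omega>. ennreal (exp (- c)) * ennreal (exp (X \<omega>)) \<partial>M)"
    by (intro nn_integral_mono) (auto simp: indicator_def mult_exp_exp simp flip: ennreal_mult ennreal_1 intro!: ennreal_leI)
  also have "\<dots> = ennreal (exp (- c)) * ennreal (exp (expectation (\<lambda>\<omega>. (X \<omega>)\<^sup>2) / 2))"
    using assms by (simp add: nn_integral_cmult gaussian_rv_exp_moment lin_gaussian lin_expectation)
  also have "\<dots> = ennreal (exp (expectation (\<lambda>\<omega>. (X \<omega>)\<^sup>2) / 2 - c))"
    by (simp add: mult_exp_exp flip: ennreal_mult)
  finally show ?thesis by (simp add: emeasure_eq_measure)
qed

text \<open>\<open>Z\<close> is uncorrelated with every combination \<open>G\<close> of the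
  \<open>X i\<close>, so the second moments of \<open>s * Z\<close> and \<open>G\<close> add up, and
  the Gaussian characteristic function turns this sum into a product.\<close>

lemma lin_uncorrelated_indep:
  assumes "finite I" "Z \<in> lin" "\<And>i. i \<in> I \<Longrightarrow> X i \<in> lin"
    and unc: "\<And>i. i \<in> I \<Longrightarrow> expectation (\<lambda>\<omega>. Z \<omega> * X i \<omega>) = 0"
    and "A \<in> sets borel" "\<And>i. i \<in> I \<Longrightarrow> B i \<in> sets borel"
  shows "prob {\<omega>\<in>space M. Z \<omega> \<in> A \<and> (\<forall>i\<in>I. X i \<omega> \<in> B i)}
    = prob {\<omega>\<in>space M. Z \<omega> \<in> A} * prob {\<omega>\<in>space M. \<forall>i\<in>I. X i \<omega> \<in> B i}"
proof (rule indep_rectangles)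
  fix s and c :: "'a \<Rightarrow> real"
  define G where "G = (\<lambda>\<omega>. \<Sum>i\<in>I. c i * X i \<omega>)"
  have G: "G \<in> lin" unfolding G_def using assms by (intro lin_sum)
  have "expectation (\<lambda>\<omega>. Z \<omega> * G \<omega>) = expectation (\<lambda>\<omega>. \<Sum>i\<in>I. c i * (Z \<omega> * X i \<omega>))"
    by (simp add: G_def sum_distrib_left mult.left_commute)
  also have "\<dots> = 0"
    using assms by (subst Bochner_Integration.integral_sum) (auto intro!: lin_integrable_prod)
  finally have ZG: "expectation (\<lambda>\<omega>. Z \<omega> * G \<omega>) = 0" .
  have sZ: "(\<lambda>\<omega>. s * Z \<omega>) \<in> lin" using assms by (intro lin_scale)
  have sum: "(\<lambda>\<omega>. s * Z \<omega> + G \<omega>) \<in> lin" using sZ G by (rule lin_add)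
  have "expectation (\<lambda>\<omega>. (s * Z \<omega> + G \<omega>)\<^sup>2) = expectation (\<lambda>\<omega>. (s * Z \<omega>)\<^sup>2) + expectation (\<lambda>\<omega>. (G \<omega>)\<^sup>2)"
    using lin_expectation_add_sq[OF assms(2) G, of s 1] ZG by (simp add: power_mult_distrib)
  then have "(CLINT \<omega>|M. iexp (s * Z \<omega> + G \<omega>)) = (CLINT \<omega>|M. iexp (s * Z \<omega>)) * (CLINT \<omega>|M. iexp (G \<omega>))"
    unfolding lin_char[OF sum] lin_char[OF sZ] lin_char[OF G] of_real_mult[symmetric]
    by (simp add: mult_exp_exp add_divide_distrib)
  then show "(CLINT \<omega>|M. iexp (s * Z \<omega> + (\<Sum>i\<in>I. c i * X i \<omega>)))
      = (CLINT \<omega>|M. iexp (s * Z \<omega>)) * (CLINT \<omega>|M. iexp (\<Sum>i\<in>I. c i * X i \<omega>))"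
    unfolding G_def .
qed (use assms in \<open>auto intro: lin_measurable\<close>)

end

section \<open>Anticoncentration of the maximum\<close>

text \<open>For a fixed event of \<open>Z\<close> both sides are finite measures in the value of
  \<open>Y\<close>, and upper half-lines determine such measures. Half-lines suit the application,
  where \<open>Y\<close> is a minimum and \<open>y < Y\<close> is a conjunction.\<close>

lemma (in prob_space) indep_var_pairI:
  fixes Y Z :: "'a \<Rightarrow> real"
  assumes [measurable]: "Y \<in> borel_measurable M" "Z \<in> borel_measurable M"
    and rect: "\<And>y A. A \<in> sets borel \<Longrightarrow> prob {\<omega>\<in>space M. Z \<omega> \<in> A \<and> y < Y \<omega>}
      = prob {\<omega>\<in>space M. Z \<omega> \<in> A} * prob {\<omega>\<in>space M. y < Y \<omega>}"
  shows "distr M (borel \<Otimes>\<^sub>M borel) (\<lambda>\<omega>. (Y \<omega>, Z \<omega>)) = distr M borel Y \<Otimes>\<^sub>M distr M borel Z"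
proof (rule pair_measure_eqI[symmetric])
  interpret Y: prob_space "distr M borel Y" by (rule prob_space_distr) simp
  interpret Z: prob_space "distr M borel Z" by (rule prob_space_distr) simp
  show "sigma_finite_measure (distr M borel Y)" "sigma_finite_measure (distr M borel Z)"
    by unfold_locales
  fix A B assume "A \<in> sets (distr M borel Y)" "B \<in> sets (distr M borel Z)"
  then have [measurable]: "A \<in> sets borel" "B \<in> sets borel" by auto
  let ?E = "{\<omega>\<in>space M. Z \<omega> \<in> B}"
  let ?N = "distr (density M (indicator ?E)) borel Y"
  let ?N' = "scale_measure (emeasure M ?E) (distr M borel Y)"
  have N: "emeasure ?N C = emeasure M {\<omega>\<in>space M. Z \<omega> \<in> B \<and> Y \<omega> \<in> C}"
    if [measurable]: "C \<in> sets borel" for C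
  proof -
    have "emeasure ?N C = (\<integral>\<^sup>+\<omega>. indicator ?E \<omega> * indicator (Y -` C \<inter> space M) \<omega> \<partial>M)"
      by (simp add: emeasure_distr emeasure_density)
    also have "\<dots> = (\<integral>\<^sup>+\<omega>. indicator {\<omega>\<in>space M. Z \<omega> \<in> B \<and> Y \<omega> \<in> C} \<omega> \<partial>M)"
      by (intro nn_integral_cong) (auto simp: indicator_def)
    finally show ?thesis by simp
  qed
  have N': "emeasure ?N' C = emeasure M ?E * emeasure M {\<omega>\<in>space M. Y \<omega> \<in> C}"
    if [measurable]: "C \<in> sets borel" for C
    by (simp add: emeasure_distr vimage_def Int_def conj_commute)
  have "?N = ?N'"
  proof (rule measure_eqI_lessThan)
    fix y
    show "emeasure ?N {y<..} = emeasure ?N' {y<..}"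
      using rect[of B y] by (subst N, simp, subst N', simp, simp add: emeasure_eq_measure flip: ennreal_mult)
    show "emeasure ?N {y<..} < \<infinity>"
      by (simp add: N emeasure_eq_measure)
  qed auto
  then have "emeasure ?N A = emeasure ?N' A" by (rule arg_cong)
  then have "emeasure M {\<omega>\<in>space M. Z \<omega> \<in> B \<and> Y \<omega> \<in> A} = emeasure M ?E * emeasure M {\<omega>\<in>space M. Y \<omega> \<in> A}"
    by (simp only: N N' \<open>A \<in> sets borel\<close>)
  then show "emeasure (distr M borel Y) A * emeasure (distr M borel Z) B
      = emeasure (distr M (borel \<Otimes>\<^sub>M borel) (\<lambda>\<omega>. (Y \<omega>, Z \<omega>))) (A \<times> B)"
    by (simp add: emeasure_distr vimage_def Int_def conj_commute conj_left_commute mult.commute)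
qed (simp cong: sets_pair_measure_cong)

context gaussian_field begin

text \<open>The law of the pair is a product, so \<open>Z\<close> is integrated first with
  \<open>Y = y\<close> fixed, and the one-dimensional estimate is then averaged over the law of
  \<open>Y\<close>.\<close>

lemma crossing_interval_le:
  assumes [measurable]: "Y \<in> borel_measurable M" "Z \<in> borel_measurable M"
    and Z: "distr M borel Z = std_normal_distribution"
    and rect: "\<And>y A. A \<in> sets borel \<Longrightarrow> prob {\<omega>\<in>space M. Z \<omega> \<in> A \<and> y < Y \<omega>}
      = prob {\<omega>\<in>space M. Z \<omega> \<in> A} * prob {\<omega>\<in>space M. y < Y \<omega>}"
    and "R \<ge> 1" "L \<ge> 0"
  shows "prob {\<omega>\<in>space M. Y \<omega> < Z \<omega> \<and> Z \<omega> \<le> Y \<omega> + L}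
    \<le> L * (exp (3/2) * R * prob {\<omega>\<in>space M. Y \<omega> < Z \<omega>} + std_normal_density R)"
proof -
  let ?\<gamma> = std_normal_distribution
  interpret N: real_distribution ?\<gamma> by (rule real_dist_normal_dist)
  interpret D: prob_space "distr M borel Y" by (rule prob_space_distr) simp
  have slice: "emeasure M {\<omega>\<in>space M. P (Y \<omega>) (Z \<omega>)} = (\<integral>\<^sup>+y. emeasure ?\<gamma> {z. P y z} \<partial>distr M borel Y)"
    if [measurable]: "{yz. P (fst yz) (snd yz)} \<in> sets (borel \<Otimes>\<^sub>M borel)" for P
  proof -
    let ?A = "{yz. P (fst yz) (snd yz)}"
    have "emeasure M {\<omega>\<in>space M. P (Y \<omega>) (Z \<omega>)} = emeasure (distr M (borel \<Otimes>\<^sub>M borel) (\<lambda>\<omega>. (Y \<omega>, Z \<omega>))) ?A"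
      by (subst emeasure_distr) (auto simp: vimage_def Int_def conj_commute)
    also have "\<dots> = emeasure (distr M borel Y \<Otimes>\<^sub>M ?\<gamma>) ?A"
      using indep_var_pairI[OF assms(1,2) rect] Z by simp
    also have "\<dots> = (\<integral>\<^sup>+y. emeasure ?\<gamma> (Pair y -` ?A) \<partial>distr M borel Y)"
      by (rule N.emeasure_pair_measure_alt) (use that in \<open>simp cong: sets_pair_measure_cong\<close>)
    finally show ?thesis by (simp add: vimage_def)
  qed
  have "{yz \<in> space (borel \<Otimes>\<^sub>M borel). fst yz < snd yz \<and> snd yz \<le> fst yz + L} \<in> sets (borel \<Otimes>\<^sub>M borel)"
    "{yz \<in> space (borel \<Otimes>\<^sub>M borel :: (real \<times> real) measure). fst yz < snd yz} \<in> sets (borel \<Otimes>\<^sub>M borel)"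
    by measurable
  then have m1: "{yz. fst yz < snd yz \<and> snd yz \<le> fst yz + L} \<in> sets (borel \<Otimes>\<^sub>M borel)"
    and m2: "{yz :: real \<times> real. fst yz < snd yz} \<in> sets (borel \<Otimes>\<^sub>M borel)"
    by (simp_all add: space_pair_measure)
  have meas [measurable]: "(\<lambda>y. emeasure ?\<gamma> {y<..}) \<in> borel_measurable borel"
  proof -
    have "(\<lambda>y. emeasure ?\<gamma> (Pair y -` {yz :: real \<times> real. fst yz < snd yz})) \<in> borel_measurable borel"
      by (rule N.measurable_emeasure_Pair) (use m2 in \<open>simp cong: sets_pair_measure_cong\<close>)
    then show ?thesis by (simp add: vimage_def greaterThan_def)
  qed
  let ?c = "L * (exp (3/2) * R)" and ?d = "L * std_normal_density R"
  have c: "?c \<ge> 0" "?d \<ge> 0" using assms by auto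
  have "emeasure M {\<omega>\<in>space M. Y \<omega> < Z \<omega> \<and> Z \<omega> \<le> Y \<omega> + L}
      = (\<integral>\<^sup>+y. emeasure ?\<gamma> {y<..y+L} \<partial>distr M borel Y)"
    by (subst slice[OF m1]) (simp add: greaterThanAtMost_def greaterThan_def atMost_def Int_def)
  also have "\<dots> \<le> (\<integral>\<^sup>+y. ennreal ?c * emeasure ?\<gamma> {y<..} + ennreal ?d \<partial>distr M borel Y)"
  proof (rule nn_integral_mono)
    fix y
    have "measure ?\<gamma> {y<..y+L} \<le> ?c * measure ?\<gamma> {y<..} + ?d"
      using std_normal_interval_le_tail[OF assms(5,6), of y] by (simp add: algebra_simps)
    then show "emeasure ?\<gamma> {y<..y+L} \<le> ennreal ?c * emeasure ?\<gamma> {y<..} + ennreal ?d"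
      using c by (simp add: N.emeasure_eq_measure ennreal_leI flip: ennreal_mult ennreal_plus)
  qed
  also have "\<dots> = ennreal ?c * (\<integral>\<^sup>+y. emeasure ?\<gamma> {y<..} \<partial>distr M borel Y) + ennreal ?d"
    by (subst nn_integral_add) (simp_all add: nn_integral_cmult D.emeasure_space_1[simplified])
  also have "(\<integral>\<^sup>+y. emeasure ?\<gamma> {y<..} \<partial>distr M borel Y) = emeasure M {\<omega>\<in>space M. Y \<omega> < Z \<omega>}"
    by (subst slice[OF m2]) (simp add: greaterThan_def)
  also have "ennreal ?c * emeasure M {\<omega>\<in>space M. Y \<omega> < Z \<omega>} + ennreal ?d
      = ennreal (?c * prob {\<omega>\<in>space M. Y \<omega> < Z \<omega>} + ?d)"
    using c by (simp add: emeasure_eq_measure flip: ennreal_mult ennreal_plus)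
  finally have "prob {\<omega>\<in>space M. Y \<omega> < Z \<omega> \<and> Z \<omega> \<le> Y \<omega> + L} \<le> ?c * prob {\<omega>\<in>space M. Y \<omega> < Z \<omega>} + ?d"
    using c by (simp only: emeasure_eq_measure ennreal_le_iff add_nonneg_nonneg mult_nonneg_nonneg measure_nonneg)
  then show ?thesis by (simp add: algebra_simps)
qed

text \<open>Regression on \<open>f t0\<close> leaves a remainder \<open>g t\<close> independent of
  it. As the coefficients \<open>a t\<close> are positive, exceedance of \<open>b\<close> means that
  \<open>Z\<close> passes a random threshold \<open>Y\<close>; as they are at least
  \<open>\<kappa>\<close>, staying at most \<open>b + \<eta>\<close> keeps \<open>Z\<close> within
  \<open>\<eta> / \<kappa>\<close> of that threshold.\<close>

lemma anticoncentration_local: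
  assumes S: "finite S" "S \<noteq> {}" "S \<subseteq> T" and t0: "t0 \<in> T"
    and \<kappa>: "\<kappa> > 0" "\<And>t. t \<in> S \<Longrightarrow> \<sigma> t > 0 \<and> \<sigma> t * r t t0 \<ge> \<kappa>"
    and "R \<ge> 1" "\<eta> \<ge> 0"
  shows "prob {\<omega>\<in>space M. (\<exists>t\<in>S. \<sigma> t * f t \<omega> + \<mu> t > b) \<and> (\<forall>t\<in>S. \<sigma> t * f t \<omega> + \<mu> t \<le> b + \<eta>)}
    \<le> \<eta> / \<kappa> * (exp (3/2) * R * prob {\<omega>\<in>space M. \<exists>t\<in>S. \<sigma> t * f t \<omega> + \<mu> t > b} + std_normal_density R)"
proof -
  define Z where "Z = f t0"
  define g where "g = (\<lambda>t \<omega>. f t \<omega> + (- r t t0) * Z \<omega>)"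
  define a where "a = (\<lambda>t. \<sigma> t * r t t0)"
  define h where "h = (\<lambda>t \<omega>. (b - \<mu> t - \<sigma> t * g t \<omega>) / a t)"
  define Y where "Y = (\<lambda>\<omega>. Min ((\<lambda>t. h t \<omega>) ` S))"
  have Z: "Z \<in> lin" unfolding Z_def using t0 by (rule lin_f)
  have g: "g t \<in> lin" if "t \<in> S" for t
    unfolding g_def using that S Z by (intro lin_add lin_f lin_scale) auto
  have [measurable]: "Z \<in> borel_measurable M" using Z by (rule lin_measurable)
  have [measurable]: "t \<in> S \<Longrightarrow> g t \<in> borel_measurable M" for t using g by (intro lin_measurable)
  have [measurable]: "t \<in> S \<Longrightarrow> h t \<in> borel_measurable M" for t unfolding h_def by measurable
  have [measurable]: "Y \<in> borel_measurable M"
    unfolding Y_def using S by (intro borel_measurable_Min) auto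
  have a: "a t \<ge> \<kappa>" "a t > 0" if "t \<in> S" for t
    using \<kappa> that by (force simp: a_def)+
  have dec: "\<sigma> t * f t \<omega> + \<mu> t = a t * Z \<omega> + \<sigma> t * g t \<omega> + \<mu> t" for t \<omega>
    by (simp add: a_def g_def algebra_simps)
  have gt: "\<sigma> t * f t \<omega> + \<mu> t > b \<longleftrightarrow> h t \<omega> < Z \<omega>" if "t \<in> S" for t \<omega>
    unfolding dec h_def using a[OF that] by (auto simp: field_simps)
  have ex: "(\<exists>t\<in>S. \<sigma> t * f t \<omega> + \<mu> t > b) \<longleftrightarrow> Y \<omega> < Z \<omega>" for \<omega>
    unfolding Y_def using S gt by (subst Min_less_iff) auto
  have all: "Z \<omega> \<le> Y \<omega> + \<eta> / \<kappa>" if "\<forall>t\<in>S. \<sigma> t * f t \<omega> + \<mu> t \<le> b + \<eta>" for \<omega>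
  proof -
    have "Y \<omega> \<in> (\<lambda>t. h t \<omega>) ` S" unfolding Y_def using S by (intro Min_in) auto
    then obtain t where t: "t \<in> S" "Y \<omega> = h t \<omega>" by auto
    have "Z \<omega> \<le> h t \<omega> + \<eta> / a t"
      using that t a[OF t(1)] unfolding dec h_def by (auto simp: field_simps)
    also have "\<eta> / a t \<le> \<eta> / \<kappa>" using a[OF t(1)] \<kappa>(1) \<open>\<eta> \<ge> 0\<close> by (intro divide_left_mono) auto
    finally show ?thesis using t by simp
  qed
  have unc: "expectation (\<lambda>\<omega>. Z \<omega> * g t \<omega>) = 0" if "t \<in> S" for t
  proof -
    have t: "t \<in> T" using that S by auto
    have "expectation (\<lambda>\<omega>. Z \<omega> * g t \<omega>) = expectation (\<lambda>\<omega>. Z \<omega> * f t \<omega> - r t t0 * (Z \<omega>)\<^sup>2)"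
      by (simp add: g_def algebra_simps power2_eq_square)
    also have "\<dots> = expectation (\<lambda>\<omega>. Z \<omega> * f t \<omega>) - r t t0 * expectation (\<lambda>\<omega>. (Z \<omega>)\<^sup>2)"
      using Z t by (subst Bochner_Integration.integral_diff)
        (auto intro!: lin_integrable_prod lin_integrable_sq integrable_mult_right lin_f)
    also have "\<dots> = 0"
      using expectation_f_sq[OF t0] by (simp add: Z_def correlation_fun_def mult.commute)
    finally show ?thesis .
  qed
  have "prob {\<omega>\<in>space M. (\<exists>t\<in>S. \<sigma> t * f t \<omega> + \<mu> t > b) \<and> (\<forall>t\<in>S. \<sigma> t * f t \<omega> + \<mu> t \<le> b + \<eta>)}
      \<le> prob {\<omega>\<in>space M. Y \<omega> < Z \<omega> \<and> Z \<omega> \<le> Y \<omega> + \<eta> / \<kappa>}"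
    using ex all by (intro finite_measure_mono) auto
  also have "\<dots> \<le> \<eta> / \<kappa> * (exp (3/2) * R * prob {\<omega>\<in>space M. Y \<omega> < Z \<omega>} + std_normal_density R)"
  proof (rule crossing_interval_le)
    \<comment> \<open>\<open>y < Y\<close> says that each \<open>g t\<close> lies in a half-line,
      and each \<open>g t\<close> is uncorrelated with \<open>Z\<close>.\<close>
    fix y A assume A: "A \<in> sets (borel :: real measure)"
    let ?B = "\<lambda>t. {x. y < (b - \<mu> t - \<sigma> t * x) / a t}"
    have yY: "y < Y \<omega> \<longleftrightarrow> (\<forall>t\<in>S. g t \<omega> \<in> ?B t)" for \<omega>
      unfolding Y_def h_def using S by (subst Min_gr_iff) auto
    show "prob {\<omega>\<in>space M. Z \<omega> \<in> A \<and> y < Y \<omega>} = prob {\<omega>\<in>space M. Z \<omega> \<in> A} * prob {\<omega>\<in>space M. y < Y \<omega>}"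
      unfolding yY by (rule lin_uncorrelated_indep) (use S Z g unc A in \<open>auto\<close>)
  qed (use assms distr_f Z_def \<open>Z \<in> borel_measurable M\<close> \<open>Y \<in> borel_measurable M\<close> in auto)
  finally show ?thesis by (simp only: ex)
qed

end

section \<open>Increment between two finite sets\<close>

context gaussian_field begin

lemma exceed_eq:
  fixes \<sigma> \<mu> :: "'p \<Rightarrow> real"
  assumes "finite S"
  shows "{\<omega> \<in> space M. (SUP t\<in>S. ereal (\<sigma> t * f t \<omega> + \<mu> t)) > ereal b}
    = {\<omega> \<in> space M. \<exists>t\<in>S. \<sigma> t * f t \<omega> + \<mu> t > b}"
  by (auto simp: less_SUP_iff)

lemma f_measurable: "t \<in> T \<Longrightarrow> f t \<in> borel_measurable M"
  by (intro lin_measurable lin_f)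

lemma exceed_measurable:
  assumes "finite S" "S \<subseteq> T"
  shows "{\<omega>\<in>space M. \<exists>t\<in>S. \<sigma> t * f t \<omega> + \<mu> t > (b :: real)} \<in> events"
  using assms f_measurable
  by (intro sets.sets_Collect_finite_Ex borel_measurable_less)
    (auto intro!: borel_measurable_add borel_measurable_times)

lemma tail_ge:
  assumes t: "t \<in> T" and "0 \<le> q" "q \<le> Q" "Q \<ge> 1"
  shows "std_normal_density q \<le> exp (3/2) * Q * prob {\<omega>\<in>space M. q < f t \<omega>}"
proof -
  note [measurable] = f_measurable[OF t]
  have "measure std_normal_distribution {q<..} = measure (distr M borel (f t)) {q<..}"
    using t by (simp add: distr_f)
  also have "\<dots> = prob {\<omega>\<in>space M. q < f t \<omega>}"
    by (subst measure_distr) (auto simp: vimage_def Int_def conj_commute)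
  finally show ?thesis using std_normal_tail_ge[OF assms(2-)] by simp
qed

text \<open>The exponential bound is applied to \<open>q * f t\<close> plus \<open>\<theta>\<close>
  times the increment \<open>s * f t - s' * f t'\<close>. The first summand yields the tail at
  \<open>q\<close>. The cross term together with \<open>m - m'\<close> stays below
  \<open>\<eta> / 2\<close> by the last assumption, and the second moment of the increment is at
  most \<open>V * x\<close>.\<close>

lemma two_point:
  assumes t: "t \<in> T" "t' \<in> T"
    and s: "0 < s" "s \<le> \<sigma>u" "0 < s'" "s' \<le> \<sigma>u"
    and x: "0 < x" "x \<le> 1" and K: "K > 0"
    and near: "\<bar>s - s'\<bar> \<le> K * x" "\<bar>m - m'\<bar> \<le> K * x" "1 - r t t' \<le> K * x"
    and q: "q = (b - m) / s" "0 \<le> q"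
    and \<eta>: "0 < \<eta>" "(q * (1 + \<sigma>u) + 1) * (K * x) \<le> \<eta> / 2"
  shows "prob {\<omega>\<in>space M. s * f t \<omega> + m > b + \<eta> \<and> s' * f t' \<omega> + m' \<le> b}
    \<le> exp (- q\<^sup>2 / 2) * exp (- \<eta>\<^sup>2 / (8 * (K\<^sup>2 + 2 * \<sigma>u\<^sup>2 * K) * x))"
proof -
  define V where "V = K\<^sup>2 + 2 * \<sigma>u\<^sup>2 * K"
  have V: "V > 0" using K by (simp add: V_def add_pos_nonneg)
  \<comment> \<open>The multiplier of the increment that optimises the exponential bound.\<close>
  define \<theta> where "\<theta> = \<eta> / (2 * (V * x))"
  have \<theta>: "\<theta> > 0" using V x \<eta> by (simp add: \<theta>_def)
  \<comment> \<open>On the event, \<open>f t\<close> is at least \<open>q\<close> and the increment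
    exceeds \<open>m' - m + \<eta>\<close>; \<open>c\<close> is the resulting lower bound for
    \<open>X\<close>.\<close>
  define c where "c = q\<^sup>2 + \<theta> * (m' - m + \<eta>)"
  define X where "X = (\<lambda>\<omega>. (q + \<theta> * s) * f t \<omega> + (- \<theta> * s') * f t' \<omega>)"
  have X: "X \<in> lin" unfolding X_def using t by (intro lin_add lin_scale lin_f)
  have [measurable]: "f t \<in> borel_measurable M" "f t' \<in> borel_measurable M" "X \<in> borel_measurable M"
    using t X by (auto intro: f_measurable lin_measurable)
  have "s * s' * (1 - r t t') \<le> s * s' * (K * x)"
    using near(3) s by (intro mult_left_mono) auto
  also have "\<dots> \<le> \<sigma>u * \<sigma>u * (K * x)"
    using s K x by (intro mult_right_mono mult_mono) auto
  finally have v1: "s * s' * (1 - r t t') \<le> \<sigma>u\<^sup>2 * (K * x)" by (simp add: power2_eq_square)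
  have "(s - s')\<^sup>2 \<le> (K * x)\<^sup>2"
    using near(1) by (metis abs_ge_zero power2_abs power_mono)
  also have "\<dots> \<le> K\<^sup>2 * x"
    using x K by (simp add: power_mult_distrib power2_eq_square mult_left_le)
  finally have v: "(s - s')\<^sup>2 + 2 * (s * s' * (1 - r t t')) \<le> V * x"
    using v1 by (simp add: V_def algebra_simps)
  have "s' * (1 - r t t') \<le> s' * (K * x)" using near(3) s by (intro mult_left_mono) auto
  also have "\<dots> \<le> \<sigma>u * (K * x)" using s K x by (intro mult_right_mono) auto
  finally have "(s - s') + s' * (1 - r t t') \<le> (1 + \<sigma>u) * (K * x)" using near(1) by (simp add: algebra_simps)
  then have "q * ((s - s') + s' * (1 - r t t')) + (m - m') \<le> q * ((1 + \<sigma>u) * (K * x)) + K * x"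
    using near(2) q(2) by (intro add_mono mult_left_mono) auto
  also have "\<dots> \<le> \<eta> / 2" using \<eta>(2) by (simp add: algebra_simps)
  finally have lin: "q * ((s - s') + s' * (1 - r t t')) + (m - m') \<le> \<eta> / 2" .
  have EX: "expectation (\<lambda>\<omega>. (X \<omega>)\<^sup>2)
      = (q + \<theta> * s)\<^sup>2 + 2 * (q + \<theta> * s) * (- \<theta> * s') * r t t' + (- \<theta> * s')\<^sup>2"
    unfolding X_def using lin_expectation_add_sq[OF lin_f lin_f, OF t, of "q + \<theta> * s" "- \<theta> * s'"]
    by (simp only: expectation_f_sq t correlation_fun_def mult_1_right)
  have "prob {\<omega>\<in>space M. s * f t \<omega> + m > b + \<eta> \<and> s' * f t' \<omega> + m' \<le> b} \<le> prob {\<omega>\<in>space M. c \<le> X \<omega>}"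
  proof (intro finite_measure_mono subsetI)
    fix \<omega> assume "\<omega> \<in> {\<omega>\<in>space M. s * f t \<omega> + m > b + \<eta> \<and> s' * f t' \<omega> + m' \<le> b}"
    then have \<omega>: "\<omega> \<in> space M" "s * f t \<omega> + m > b + \<eta>" "s' * f t' \<omega> + m' \<le> b" by auto
    have "f t \<omega> \<ge> q" using \<omega>(2) s \<eta> by (simp add: q(1) field_simps)
    then have "0 \<le> q * (f t \<omega> - q)" using q(2) by simp
    moreover have "0 \<le> \<theta> * (s * f t \<omega> - s' * f t' \<omega> - (m' - m + \<eta>))"
      using \<omega> \<theta> by simp
    ultimately have "0 \<le> X \<omega> - c"
      by (simp add: X_def c_def algebra_simps power2_eq_square)
    then show "\<omega> \<in> {\<omega>\<in>space M. c \<le> X \<omega>}" using \<omega> by simp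
  qed auto
  also have "\<dots> \<le> exp (expectation (\<lambda>\<omega>. (X \<omega>)\<^sup>2) / 2 - c)"
    by (rule lin_chernoff[OF X])
  \<comment> \<open>Regrouped by powers of \<open>\<theta>\<close>, with
    \<open>s - s' * r t t'\<close> written as \<open>(s - s') + s' * (1 - r t t')\<close>, so that
    only small quantities appear.\<close>
  also have "expectation (\<lambda>\<omega>. (X \<omega>)\<^sup>2) / 2 - c = - q\<^sup>2 / 2
      + \<theta> * (q * ((s - s') + s' * (1 - r t t')) + (m - m'))
      + \<theta>\<^sup>2 / 2 * ((s - s')\<^sup>2 + 2 * (s * s' * (1 - r t t'))) - \<theta> * \<eta>"
    unfolding EX c_def by (simp add: field_simps power2_eq_square)
  also have "\<dots> \<le> - q\<^sup>2 / 2 + \<theta> * (\<eta> / 2) + \<theta>\<^sup>2 / 2 * (V * x) - \<theta> * \<eta>"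
    using lin v \<theta> by (intro diff_right_mono add_mono mult_left_mono) auto
  also have "\<dots> = - q\<^sup>2 / 2 + - \<eta>\<^sup>2 / (8 * V * x)"
    using V x by (simp add: \<theta>_def field_simps power2_eq_square)
  finally show ?thesis
    by (simp add: V_def mult_exp_exp)
qed

text \<open>\<open>w\<close> has two roles: it dominates the exceedance probability on
  \<open>S'\<close> and, up to a factor, the density at every standardised level. Thus both error
  terms become multiples of \<open>w\<close>.\<close>

lemma increment_bound:
  fixes \<sigma> \<mu> :: "'p \<Rightarrow> real"
  assumes fin: "finite S" "S \<subseteq> T" "finite S'" "S' \<subseteq> T" "finite J" "J \<subseteq> T"
    and cover: "\<And>t. t \<in> S' \<Longrightarrow> \<exists>t0\<in>J. r t t0 \<ge> 1/2"
    and \<sigma>: "0 < \<sigma>l" "\<And>t. t \<in> T \<Longrightarrow> \<sigma>l \<le> \<sigma> t \<and> \<sigma> t \<le> \<sigma>u"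
    and x: "0 < x" "x \<le> 1" and K: "K > 0"
    and near: "\<And>t. t \<in> S' \<Longrightarrow> \<exists>t'\<in>S. \<bar>\<sigma> t - \<sigma> t'\<bar> \<le> K * x \<and> \<bar>\<mu> t - \<mu> t'\<bar> \<le> K * x \<and> 1 - r t t' \<le> K * x"
    and q: "\<And>t. t \<in> T \<Longrightarrow> 0 \<le> (b - \<mu> t) / \<sigma> t \<and> (b - \<mu> t) / \<sigma> t \<le> Q" and Q: "Q \<ge> 1"
    and \<eta>: "0 < \<eta>" "(Q * (1 + \<sigma>u) + 1) * (K * x) \<le> \<eta> / 2"
    and w: "\<And>t. t \<in> T \<Longrightarrow> std_normal_density ((b - \<mu> t) / \<sigma> t) \<le> exp (3/2) * Q * w"
    and wS: "prob {\<omega>\<in>space M. \<exists>t\<in>S'. \<sigma> t * f t \<omega> + \<mu> t > b} \<le> w"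
  shows "prob {\<omega>\<in>space M. \<exists>t\<in>S'. \<sigma> t * f t \<omega> + \<mu> t > b}
    - prob {\<omega>\<in>space M. \<exists>t\<in>S. \<sigma> t * f t \<omega> + \<mu> t > b}
    \<le> card J * (\<eta> / (\<sigma>l / 2) * (2 * (exp (3/2) * Q * w)))
      + card S' * (sqrt (2 * pi) * (exp (3/2) * Q * w) * exp (- \<eta>\<^sup>2 / (8 * (K\<^sup>2 + 2 * \<sigma>u\<^sup>2 * K) * x)))"
proof -
  define X where "X = (\<lambda>t \<omega>. \<sigma> t * f t \<omega> + \<mu> t)"
  \<comment> \<open>The piece of \<open>S'\<close> on which the regression on \<open>f t0\<close>
    has coefficient at least \<open>\<sigma>l / 2\<close>.\<close>
  define S'' where "S'' = (\<lambda>t0. {t\<in>S'. r t t0 \<ge> 1/2})"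
  define E where "E = (\<lambda>t0. {\<omega>\<in>space M. (\<exists>t\<in>S'' t0. X t \<omega> > b) \<and> (\<forall>t\<in>S'' t0. X t \<omega> \<le> b + \<eta>)})"
  obtain p where p: "\<And>t. t \<in> S' \<Longrightarrow> p t \<in> S \<and> \<bar>\<sigma> t - \<sigma> (p t)\<bar> \<le> K * x \<and> \<bar>\<mu> t - \<mu> (p t)\<bar> \<le> K * x \<and> 1 - r t (p t) \<le> K * x"
    using near by metis
  define F where "F = (\<lambda>t. {\<omega>\<in>space M. X t \<omega> > b + \<eta> \<and> X (p t) \<omega> \<le> b})"
  have \<sigma>pos: "\<sigma> t > 0" if "t \<in> T" for t using \<sigma> that by force
  have mX [measurable]: "t \<in> T \<Longrightarrow> X t \<in> borel_measurable M" for t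
    using f_measurable unfolding X_def by measurable
  have S'': "finite (S'' t0)" "S'' t0 \<subseteq> T" for t0 using fin by (auto simp: S''_def)
  have w0: "w \<ge> 0" using wS measure_nonneg[of M] order_trans by blast
  have mex: "{\<omega>\<in>space M. \<exists>t\<in>A. X t \<omega> > c} \<in> events" if "finite A" "A \<subseteq> T" for A c
    using that mX by (intro sets.sets_Collect_finite_Ex) (auto intro!: borel_measurable_less)
  have mE: "E t0 \<in> events" for t0
  proof -
    have "E t0 = {\<omega>\<in>space M. \<exists>t\<in>S'' t0. X t \<omega> > b} - {\<omega>\<in>space M. \<exists>t\<in>S'' t0. X t \<omega> > b + \<eta>}"
      by (auto simp: E_def not_less)
    then show ?thesis using mex[OF S''] by simp
  qed
  have mF: "F t \<in> events" if "t \<in> S'" for t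
  proof -
    have "t \<in> T" "p t \<in> T" using that p[OF that] fin by auto
    then have [measurable]: "X t \<in> borel_measurable M" "X (p t) \<in> borel_measurable M"
      by (auto intro: mX)
    show ?thesis unfolding F_def by measurable
  qed
  let ?A = "\<lambda>S. {\<omega>\<in>space M. \<exists>t\<in>S. X t \<omega> > b}"
  \<comment> \<open>Either all of \<open>S'\<close> stays at most \<open>b + \<eta>\<close>, and a
    piece containing an exceedance point gives an event \<open>E t0\<close>; or some
    \<open>t1\<close> passes \<open>b + \<eta>\<close>, and then \<open>p t1\<close> exceeds
    \<open>b\<close> too or \<open>F t1\<close> occurs.\<close>
  have sub: "?A S' \<subseteq> ?A S \<union> ((\<Union>t0\<in>J. E t0) \<union> (\<Union>t\<in>S'. F t))"
  proof
    fix \<omega> assume \<omega>: "\<omega> \<in> ?A S'"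
    then obtain t where t: "t \<in> S'" "X t \<omega> > b" "\<omega> \<in> space M" by auto
    obtain t0 where t0: "t0 \<in> J" "r t t0 \<ge> 1/2" using cover t by auto
    show "\<omega> \<in> ?A S \<union> ((\<Union>t0\<in>J. E t0) \<union> (\<Union>t\<in>S'. F t))"
    proof (cases "\<forall>t\<in>S'. X t \<omega> \<le> b + \<eta>")
      case True
      then have "\<omega> \<in> E t0" using t t0 by (auto simp: E_def S''_def)
      then show ?thesis using t0 by auto
    next
      case False
      then obtain t1 where t1: "t1 \<in> S'" "X t1 \<omega> > b + \<eta>" by (auto simp: not_le)
      show ?thesis
      proof (cases "X (p t1) \<omega> > b")
        case True
        then show ?thesis using t p[OF t1(1)] by auto
      next
        case False
        then have "\<omega> \<in> F t1" using t1 t by (auto simp: F_def)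
        then show ?thesis using t1 by auto
      qed
    qed
  qed
  have EB: "prob (E t0) \<le> \<eta> / (\<sigma>l / 2) * (2 * (exp (3/2) * Q * w))" if t0: "t0 \<in> J" for t0
  proof (cases "S'' t0 = {}")
    case True
    then have "E t0 = {}" by (simp add: E_def)
    then show ?thesis using \<eta> \<sigma> w0 Q by simp
  next
    case False
    then obtain t where t: "t \<in> S'' t0" by auto
    have tT: "t \<in> T" using t S'' by auto
    \<comment> \<open>With \<open>R = Q\<close> the additive term of the anticoncentration bound is
      also a multiple of \<open>w\<close>, because \<open>Q\<close> dominates every standardised
      level.\<close>
    have "std_normal_density Q \<le> std_normal_density ((b - \<mu> t) / \<sigma> t)"
      using q[OF tT] by (intro std_normal_density_antimono) auto
    also have "\<dots> \<le> exp (3/2) * Q * w" by (rule w[OF tT])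
    finally have \<phi>: "std_normal_density Q \<le> exp (3/2) * Q * w" .
    have "prob (?A (S'' t0)) \<le> prob (?A S')"
      using mex fin by (intro finite_measure_mono) (auto simp: S''_def)
    then have "prob (?A (S'' t0)) \<le> w" using wS by (simp add: X_def)
    then have "exp (3/2) * Q * prob (?A (S'' t0)) \<le> exp (3/2) * Q * w"
      using Q by (intro mult_left_mono) auto
    note b = add_mono[OF this \<phi>]
    have "\<sigma> t > 0 \<and> \<sigma>l / 2 \<le> \<sigma> t * r t t0" if "t \<in> S'' t0" for t
    proof -
      have tT: "t \<in> T" using that S'' by auto
      have "\<sigma>l * (1/2) \<le> \<sigma> t * r t t0"
        using that \<sigma>(1) \<sigma>(2)[OF tT] by (intro mult_mono) (auto simp: S''_def)
      then show ?thesis using \<sigma>pos[OF tT] by simp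
    qed
    then have "prob (E t0) \<le> \<eta> / (\<sigma>l / 2) * (exp (3/2) * Q * prob (?A (S'' t0)) + std_normal_density Q)"
      unfolding E_def X_def using S'' False t0 fin \<sigma> \<eta> Q
      by (intro anticoncentration_local[where ?t0.0 = t0]) auto
    also have "\<dots> \<le> \<eta> / (\<sigma>l / 2) * (2 * (exp (3/2) * Q * w))"
      using \<eta> \<sigma> by (intro mult_left_mono order_trans[OF b]) auto
    finally show ?thesis .
  qed
  have FB: "prob (F t) \<le> sqrt (2 * pi) * (exp (3/2) * Q * w) * exp (- \<eta>\<^sup>2 / (8 * (K\<^sup>2 + 2 * \<sigma>u\<^sup>2 * K) * x))"
    if t: "t \<in> S'" for t
  proof -
    let ?q = "(b - \<mu> t) / \<sigma> t"
    have tT: "t \<in> T" "p t \<in> T" using t p fin by auto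
    have u: "\<sigma>u > 0" using \<sigma> tT \<sigma>pos by force
    have "(?q * (1 + \<sigma>u) + 1) * (K * x) \<le> (Q * (1 + \<sigma>u) + 1) * (K * x)"
      using q[OF tT(1)] u K x by (intro mult_right_mono add_mono) auto
    with \<eta> have \<eta>': "(?q * (1 + \<sigma>u) + 1) * (K * x) \<le> \<eta> / 2" by linarith
    have "prob (F t) \<le> exp (- ?q\<^sup>2 / 2) * exp (- \<eta>\<^sup>2 / (8 * (K\<^sup>2 + 2 * \<sigma>u\<^sup>2 * K) * x))"
      unfolding F_def X_def
      using tT \<sigma>pos \<sigma> x K p[OF t] q \<eta> \<eta>' by (intro two_point) auto
    also have "exp (- ?q\<^sup>2 / 2) = sqrt (2 * pi) * std_normal_density ?q"
      by (simp add: std_normal_density_def)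
    also have "\<dots> * exp (- \<eta>\<^sup>2 / (8 * (K\<^sup>2 + 2 * \<sigma>u\<^sup>2 * K) * x))
        \<le> sqrt (2 * pi) * (exp (3/2) * Q * w) * exp (- \<eta>\<^sup>2 / (8 * (K\<^sup>2 + 2 * \<sigma>u\<^sup>2 * K) * x))"
      using w[OF tT(1)] by (intro mult_right_mono mult_left_mono) auto
    finally show ?thesis .
  qed
  have "prob (?A S') \<le> prob (?A S \<union> ((\<Union>t0\<in>J. E t0) \<union> (\<Union>t\<in>S'. F t)))"
    using mex fin mE mF by (intro finite_measure_mono sub sets.Un sets.finite_UN) auto
  also have "\<dots> \<le> prob (?A S) + (prob (\<Union>t0\<in>J. E t0) + prob (\<Union>t\<in>S'. F t))"
    using mex fin mE mF
    by (intro order_trans[OF measure_Un_le] add_left_mono sets.Un sets.finite_UN) auto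
  also have "prob (\<Union>t0\<in>J. E t0) \<le> (\<Sum>t0\<in>J. prob (E t0))"
    using fin mE by (intro measure_UNION_le) auto
  also have "\<dots> \<le> card J * (\<eta> / (\<sigma>l / 2) * (2 * (exp (3/2) * Q * w)))"
    by (rule sum_bounded_above) (rule EB)
  also have "prob (\<Union>t\<in>S'. F t) \<le> (\<Sum>t\<in>S'. prob (F t))"
    using fin mF by (intro measure_UNION_le) auto
  also have "\<dots> \<le> card S' * (sqrt (2 * pi) * (exp (3/2) * Q * w) * exp (- \<eta>\<^sup>2 / (8 * (K\<^sup>2 + 2 * \<sigma>u\<^sup>2 * K) * x)))"
    by (rule sum_bounded_above) (rule FB)
  finally show ?thesis by (simp add: X_def algebra_simps)
qed

end

section \<open>Lattices and exceedance probabilities\<close>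

lemma lattice_points_subset: "lattice_points T n \<subseteq> T"
  by (auto simp: lattice_points_def)

lemma lattice_points_double: "lattice_points T n \<subseteq> lattice_points T (2 * n)"
proof
  fix t assume "t \<in> lattice_points T n"
  then obtain i :: "'a \<Rightarrow> int" where t: "t \<in> T" "t = (\<chi> j. of_int (i j) / of_nat n)"
    unfolding lattice_points_def by auto
  have "t = (\<chi> j. of_int (2 * i j) / of_nat (2 * n))" by (simp add: t(2))
  then show "t \<in> lattice_points T (2 * n)"
    using t(1) unfolding lattice_points_def by (intro IntI CollectI exI[of _ "\<lambda>j. 2 * i j"]) auto
qed

lemma card_lattice_points_le:
  fixes T :: "(real ^ 'd) set"
  assumes "bounded T"
  shows "\<exists>C>0. \<forall>n>0. finite (lattice_points T n) \<and> real (card (lattice_points T n)) \<le> (C * real n) ^ CARD('d)"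
proof -
  obtain B where B: "\<And>t. t \<in> T \<Longrightarrow> norm t \<le> B"
    using assms bounded_iff by blast
  obtain D :: nat where D: "D > 0" "B \<le> real D"
    using real_arch_simple[of "max 1 B"] by (metis gr0I max.bounded_iff not_one_le_zero of_nat_0)
  have "finite (lattice_points T n) \<and> real (card (lattice_points T n)) \<le> (real (3 * D) * real n) ^ CARD('d)"
    if n: "n > 0" for n
  proof -
    let ?I = "{- int (D * n)..int (D * n)}"
    let ?P = "PiE (UNIV :: 'd set) (\<lambda>_. ?I)"
    have sub: "lattice_points T n \<subseteq> (\<lambda>i. \<chi> j. of_int (i j) / of_nat n) ` ?P"
    proof
      fix t assume "t \<in> lattice_points T n"
      then obtain i :: "'d \<Rightarrow> int" where t: "t \<in> T" "t = (\<chi> j. of_int (i j) / of_nat n)"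
        unfolding lattice_points_def by auto
      have "\<bar>i j\<bar> \<le> int (D * n)" for j
      proof -
        have "\<bar>real_of_int (i j) / real n\<bar> \<le> real D"
          using component_le_norm_cart[of t j] B[OF t(1)] D by (simp add: t(2))
        then have "\<bar>real_of_int (i j)\<bar> \<le> real D * real n"
          using n by (simp add: abs_divide divide_le_eq)
        then have "real_of_int \<bar>i j\<bar> \<le> real_of_int (int (D * n))" by simp
        then show ?thesis by (simp only: of_int_le_iff)
      qed
      then have "i \<in> ?P" by (auto simp: abs_le_iff) (metis minus_le_iff)+
      then show "t \<in> (\<lambda>i. \<chi> j. of_int (i j) / of_nat n) ` ?P" using t(2) by auto
    qed
    have fin: "finite ?P" by (intro finite_PiE) auto
    have "card (lattice_points T n) \<le> card ?P"
      using sub fin by (meson card_image_le card_mono finite_imageI le_trans)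
    also have "\<dots> = (2 * (D * n) + 1) ^ CARD('d)"
      by (simp add: card_PiE nat_add_distrib nat_mult_distrib)
    \<comment> \<open>The added one is absorbed because \<open>D * n \<ge> 1\<close>.\<close>
    also have "\<dots> \<le> (3 * D * n) ^ CARD('d)"
      using n D by (intro power_mono) (simp_all add: Suc_le_eq)
    finally have "real (card (lattice_points T n)) \<le> real ((3 * D * n) ^ CARD('d))" by linarith
    then show ?thesis using finite_subset[OF sub] fin by simp
  qed
  then show ?thesis using D by (intro exI[of _ "real (3 * D)"]) auto
qed

section \<open>Passage from finite lattices to the supremum over \<open>T\<close>\<close>

lemma covering_radius_near:
  assumes "covering_radius T S \<le> ereal c" "c < e" "t \<in> T"
  obtains t' where "t' \<in> S" "dist t t' < e"
proof -
  have "(INF t'\<in>S. ereal (dist t t')) \<le> ereal c"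
    using assms unfolding covering_radius_def by (meson SUP_upper order_trans)
  also have "\<dots> < ereal e" using assms by simp
  finally show thesis using that by (auto simp: INF_less_iff)
qed

text \<open>For a continuous path a strict exceedance at \<open>t\<close> persists at points of
  \<open>L k\<close> close to \<open>t\<close>. Hence the event of the supremum differs from a
  measurable union by a subset of a null set, which has measure zero in the completion.\<close>

lemma exceed_prob_eq_Union:
  fixes T :: "'p::metric_space set" and L :: "nat \<Rightarrow> 'p set"
  assumes "gaussian_field M T f"
    and cont: "AE \<omega> in M. continuous_on T (\<lambda>t. f t \<omega>)"
    and \<sigma>: "continuous_on T \<sigma>" and \<mu>: "continuous_on T \<mu>"
    and L: "\<And>k. finite (L k)" "\<And>k. L k \<subseteq> T"
    and dense: "\<And>t. t \<in> T \<Longrightarrow> \<exists>s. (\<forall>k. s k \<in> L k) \<and> s \<longlonglongrightarrow> t"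
  shows "exceed_prob M f T \<sigma> \<mu> b = measure M (\<Union>k. {\<omega>\<in>space M. \<exists>t\<in>L k. \<sigma> t * f t \<omega> + \<mu> t > b})"
proof -
  interpret gaussian_field M T f by fact
  let ?A = "\<Union>k. {\<omega>\<in>space M. \<exists>t\<in>L k. \<sigma> t * f t \<omega> + \<mu> t > b}"
  let ?E = "{\<omega>\<in>space M. (SUP t\<in>T. ereal (\<sigma> t * f t \<omega> + \<mu> t)) > ereal b}"
  have "{\<omega>\<in>space M. \<exists>t\<in>L k. \<sigma> t * f t \<omega> + \<mu> t > b} \<in> events" for k
    using L by (rule exceed_measurable)
  then have A: "?A \<in> events" by auto
  from cont obtain Nn where Nn: "Nn \<in> null_sets M" "\<And>\<omega>. \<omega> \<in> space M \<Longrightarrow> \<omega> \<notin> Nn \<Longrightarrow> continuous_on T (\<lambda>t. f t \<omega>)"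
    by (auto simp: eventually_ae_filter)
  have "?A \<subseteq> ?E" using L by (auto simp: less_SUP_iff)
  moreover have "?E - ?A \<subseteq> Nn"
  proof (rule ccontr)
    assume "\<not> ?E - ?A \<subseteq> Nn"
    then obtain \<omega> where \<omega>: "\<omega> \<in> ?E" "\<omega> \<notin> ?A" "\<omega> \<notin> Nn" by auto
    then obtain t where t: "t \<in> T" "\<sigma> t * f t \<omega> + \<mu> t > b" by (auto simp: less_SUP_iff)
    obtain s where s: "\<And>k. s k \<in> L k" "s \<longlonglongrightarrow> t" using dense[OF t(1)] by auto
    have "continuous_on T (\<lambda>t. \<sigma> t * f t \<omega> + \<mu> t)"
      using \<sigma> \<mu> Nn(2)[of \<omega>] \<omega> by (intro continuous_intros) auto
    then have "(\<lambda>k. \<sigma> (s k) * f (s k) \<omega> + \<mu> (s k)) \<longlonglongrightarrow> \<sigma> t * f t \<omega> + \<mu> t"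
      using s t L by (elim continuous_on_tendsto_compose) (auto intro!: always_eventually)
    then have "eventually (\<lambda>k. \<sigma> (s k) * f (s k) \<omega> + \<mu> (s k) > b) sequentially"
      using t(2) by (rule order_tendstoD)
    then obtain k where "\<sigma> (s k) * f (s k) \<omega> + \<mu> (s k) > b"
      by (auto simp: eventually_sequentially)
    then have "\<omega> \<in> ?A" using \<omega>(1) s(1) by blast
    with \<omega>(2) show False by simp
  qed
  ultimately have E: "?E = ?A \<union> (?E - ?A)" "?E - ?A \<in> null_sets (completion M)"
    using Nn(1) by (auto intro: completion.complete2 simp: null_sets_completion_iff2) 
  have "measure (completion M) (?A \<union> (?E - ?A)) = measure (completion M) ?A"
    by (rule measure_Un_null_set[OF sets_completionI_sets[OF A] E(2)])
  then have "measure (completion M) ?E = measure (completion M) ?A"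
    unfolding E(1)[symmetric] .
  also have "\<dots> = measure M ?A" using A by (rule measure_completion)
  finally show ?thesis by (simp add: exceed_prob_def)
qed

lemma exceed_prob_finite:
  assumes "gaussian_field M T f" "finite S" "S \<subseteq> T"
  shows "exceed_prob M f S \<sigma> \<mu> b = measure M {\<omega>\<in>space M. \<exists>t\<in>S. \<sigma> t * f t \<omega> + \<mu> t > b}"
proof -
  interpret gaussian_field M T f by fact
  have "{\<omega>\<in>space M. \<exists>t\<in>S. \<sigma> t * f t \<omega> + \<mu> t > b} \<in> events"
    using assms(2,3) by (rule exceed_measurable)
  then show ?thesis
    unfolding exceed_prob_def exceed_eq[OF assms(2)] by (rule measure_completion)
qed

section \<open>Elementary estimates of powers and exponentials\<close>

lemma powr_mult_exp_bounded:
  assumes "c > 0" "a > 0"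
  shows "\<exists>C. \<forall>x\<ge>1. x powr p * exp (- c * x powr a) \<le> (C :: real)"
proof -
  \<comment> \<open>A single term of the exponential series, of degree \<open>m\<close> with
    \<open>a * m \<ge> p\<close>, already dominates the power.\<close>
  obtain m :: nat where m: "p / a \<le> real m" using real_arch_simple by blast
  have "x powr p * exp (- c * x powr a) \<le> fact m / c ^ m" if x: "x \<ge> 1" for x
  proof -
    have "p \<le> a * real m" using m assms by (simp add: divide_le_eq mult.commute)
    then have "x powr p \<le> x powr (a * real m)" using x by (intro powr_mono) auto
    also have "\<dots> = (c * x powr a) ^ m / fact m * (fact m / c ^ m)"
      using assms x by (simp add: power_mult_distrib powr_powr[symmetric] powr_realpow)
    also have "\<dots> \<le> exp (c * x powr a) * (fact m / c ^ m)"
    proof (intro mult_right_mono)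
      have "(c * x powr a) ^ m / fact m = (\<Sum>k\<in>{m}. (c * x powr a) ^ k /\<^sub>R fact k)"
        by (simp add: divide_inverse mult.commute)
      also have "\<dots> \<le> exp (c * x powr a)"
        unfolding exp_def using assms by (intro sum_le_suminf summable_exp_generic) auto
      finally show "(c * x powr a) ^ m / fact m \<le> exp (c * x powr a)" .
    qed (use assms in auto)
    finally have "x powr p * exp (- c * x powr a) \<le> exp (c * x powr a) * (fact m / c ^ m) * exp (- c * x powr a)"
      by (intro mult_right_mono) auto
    then show ?thesis by (simp add: exp_minus field_simps)
  qed
  then show ?thesis by blast
qed

text \<open>The exponent of \<open>b\<close> in \<open>N0\<close> is at least \<open>4 / bs\<close>,
  and the factor in \<open>e\<close> is at least one. This serves the smallness condition on the
  mesh in \<open>increment_bound\<close>.\<close>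

lemma N0_ge_power:
  assumes "bs > 0" "e0 > 0" "0 < e" "e < 1" "b \<ge> 1" "N0 d bs e0 e b \<le> x"
  shows "b\<^sup>2 \<le> x powr (bs / 2)"
proof -
  have "b\<^sup>2 = (b powr (4 / bs) * 1) powr (bs / 2)"
    using assms by (simp add: powr_powr powr_realpow[symmetric] flip: powr_numeral)
  also have "\<dots> \<le> (N0 d bs e0 e b) powr (bs / 2)"
  proof (intro powr_mono2)
    have "4 / bs \<le> 2 / bs * (3 * real d / bs + 2 + e0)"
      using assms by (simp add: field_simps)
    then have "b powr (4 / bs) \<le> b powr (2 / bs * (3 * real d / bs + 2 + e0))"
      using assms by (intro powr_mono) auto
    moreover have "1 \<le> e powr (- (2 / bs) - e0)"
    proof -
      have "0 \<le> 2 / bs" using assms by simp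
      then have "- (2 / bs) - e0 \<le> 0" using assms by linarith
      then have "e powr 0 \<le> e powr (- (2 / bs) - e0)"
        using assms by (intro powr_mono') auto
      then show ?thesis using assms by simp
    qed
    ultimately show "b powr (4 / bs) * 1 \<le> N0 d bs e0 e b"
      unfolding N0_def using assms by (intro mult_mono) auto
  qed (use assms in auto)
  also have "\<dots> \<le> x powr (bs / 2)" using assms by (intro powr_mono2) (auto simp: N0_def)
  finally show ?thesis .
qed

text \<open>The power \<open>- (bs * \<rho> / 2)\<close> of \<open>N0\<close> leaves
  \<open>e\<close> with an exponent \<open>\<rho> * (1 + e0 * bs / 2) \<ge> 1\<close> and
  \<open>b\<close> with an exponent at most \<open>- (3/2)\<close>; for the latter the summand
  \<open>2\<close> in \<open>N0\<close> and \<open>\<rho> \<ge> 3/4\<close> suffice.\<close>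

lemma N0_powr_le:
  assumes "bs > 0" "e0 > 0" "0 < e" "e < 1" "b \<ge> 1" "N0 d bs e0 e b \<le> x"
    and \<rho>: "3 / 4 \<le> \<rho>" "1 / (1 + e0 * bs / 2) \<le> \<rho>"
  shows "x powr - (bs * \<rho> / 2) \<le> b powr (- (3/2)) * e"
proof -
  have exps: "2 / bs * (3 * real d / bs + 2 + e0) * - (bs * \<rho> / 2) = - (\<rho> * (3 * real d / bs + 2 + e0))"
    "(- (2 / bs) - e0) * - (bs * \<rho> / 2) = \<rho> * (1 + e0 * bs / 2)"
    using assms by (simp_all add: field_simps)
  have N0pos: "N0 d bs e0 e b > 0" using assms by (simp add: N0_def)
  have "x powr - (bs * \<rho> / 2) \<le> (N0 d bs e0 e b) powr - (bs * \<rho> / 2)"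
    using N0pos assms by (intro powr_mono2') auto
  also have "\<dots> = b powr (- (\<rho> * (3 * real d / bs + 2 + e0))) * e powr (\<rho> * (1 + e0 * bs / 2))"
    by (simp only: N0_def powr_mult powr_powr exps)
  also have "\<dots> \<le> b powr (- (3/2)) * e powr 1"
  proof (rule mult_mono)
    have "3/4 * 2 \<le> \<rho> * (3 * real d / bs + 2 + e0)"
      using assms by (intro mult_mono) auto
    then show "b powr (- (\<rho> * (3 * real d / bs + 2 + e0))) \<le> b powr (- (3/2))"
      using assms by (intro powr_mono) auto
    have "1 + e0 * bs / 2 > 0" using assms by (simp add: add_pos_pos)
    then have "1 \<le> \<rho> * (1 + e0 * bs / 2)" using \<rho>(2) by (simp only: divide_le_eq if_True)
    then show "e powr (\<rho> * (1 + e0 * bs / 2)) \<le> e powr 1"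
      using assms by (intro powr_mono') auto
  qed auto
  finally show ?thesis using assms by simp
qed

section \<open>Hoelder bounds on the lattice scale and covering by correlation\<close>

lemma hoelder_continuous_on:
  fixes g :: "'p::real_normed_vector \<Rightarrow> real"
  assumes "\<beta> > 0" "\<And>s t. s \<in> T \<Longrightarrow> t \<in> T \<Longrightarrow> \<bar>g t - g s\<bar> \<le> C * norm (s - t) powr \<beta>"
  shows "continuous_on T g"
  unfolding continuous_on_def
proof
  fix t assume t: "t \<in> T"
  have "((\<lambda>s. C * norm (s - t) powr \<beta>) \<longlongrightarrow> C * norm (t - t) powr \<beta>) (at t within T)"
    using assms(1) by (intro tendsto_intros tendsto_powr') (auto simp: always_eventually)
  then have "((\<lambda>s. C * norm (s - t) powr \<beta>) \<longlongrightarrow> 0) (at t within T)" by simp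
  then have "((\<lambda>s. g s - g t) \<longlongrightarrow> 0) (at t within T)"
  proof (rule Lim_null_comparison[rotated])
    show "eventually (\<lambda>s. norm (g s - g t) \<le> C * norm (s - t) powr \<beta>) (at t within T)"
      using assms(2)[OF _ t] assms(2)[OF t]
      by (auto simp: eventually_at_topological norm_minus_commute)
  qed
  then show "(g \<longlongrightarrow> g t) (at t within T)" by (simp add: LIM_zero_iff)
qed

text \<open>Brings both Hoelder exponents to the common rate \<open>bs\<close>, their minimum; as
  \<open>real n \<ge> 1\<close>, the smaller exponent gives the weaker bound.\<close>

lemma powr_scale_le:
  fixes x h :: real
  assumes "0 \<le> x" "x \<le> h / real n" "n > 0" "0 < bs" "bs \<le> \<gamma>"
  shows "x powr \<gamma> \<le> h powr \<gamma> * real n powr (- bs)"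
proof -
  have h: "h \<ge> 0" using assms by (metis divide_less_0_iff le_less_trans not_le of_nat_0_less_iff)
  have "x powr \<gamma> \<le> (h / real n) powr \<gamma>" using assms by (intro powr_mono2) auto
  also have "\<dots> = h powr \<gamma> * real n powr (- \<gamma>)"
    using assms h by (simp add: powr_divide powr_minus_divide)
  also have "\<dots> \<le> h powr \<gamma> * real n powr (- bs)"
    using assms by (intro mult_left_mono powr_mono) auto
  finally show ?thesis .
qed

lemma compact_cover_correlation:
  fixes T :: "'p::real_normed_vector set"
  assumes "compact T" "\<beta> > 0" "C > 0" "\<And>t t0. t \<in> T \<Longrightarrow> t0 \<in> T \<Longrightarrow> 1 - c t t0 \<le> C * norm (t - t0) powr \<beta>"
  shows "\<exists>J. finite J \<and> J \<subseteq> T \<and> (\<forall>t\<in>T. \<exists>t0\<in>J. c t t0 \<ge> (1/2 :: real))"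
proof -
  \<comment> \<open>The radius at which the Hoelder bound equals \<open>1/2\<close>.\<close>
  define \<delta> where "\<delta> = (1 / (2 * C)) powr (1 / \<beta>)"
  have \<delta>: "\<delta> > 0" "\<delta> powr \<beta> = 1 / (2 * C)" using assms by (simp_all add: \<delta>_def powr_powr)
  obtain J where J: "J \<subseteq> T" "finite J" "T \<subseteq> (\<Union>t0\<in>J. ball t0 \<delta>)"
    using compactE_image[OF assms(1), of T "\<lambda>t0. ball t0 \<delta>"] \<delta>(1) by force
  have "\<exists>t0\<in>J. c t t0 \<ge> 1/2" if t: "t \<in> T" for t
  proof -
    obtain t0 where t0: "t0 \<in> J" "dist t0 t < \<delta>" using J t by auto
    have "norm (t - t0) powr \<beta> \<le> \<delta> powr \<beta>"
      using t0 assms by (intro powr_mono2) (auto simp: dist_norm norm_minus_commute)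
    then have "C * norm (t - t0) powr \<beta> \<le> C * (1 / (2 * C))"
      using \<delta> assms by (intro mult_left_mono) auto
    then have "1 - c t t0 \<le> 1/2" using assms(4)[OF t, of t0] t0 J assms(3) by auto
    then show ?thesis using t0 by auto
  qed
  then show ?thesis using J by blast
qed

lemma exceed_prob_ge_single:
  fixes T :: "'p::metric_space set" and L :: "nat \<Rightarrow> 'p set"
  assumes "gaussian_field M T f" "AE \<omega> in M. continuous_on T (\<lambda>t. f t \<omega>)"
    "continuous_on T \<sigma>" "continuous_on T \<mu>"
    and L: "\<And>k. finite (L k)" "\<And>k. L k \<subseteq> T" "\<And>t. t \<in> T \<Longrightarrow> \<exists>s. (\<forall>k. s k \<in> L k) \<and> s \<longlonglongrightarrow> t"
    and t: "t \<in> T"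
  shows "measure M {\<omega>\<in>space M. \<sigma> t * f t \<omega> + \<mu> t > b} \<le> exceed_prob M f T \<sigma> \<mu> b"
proof -
  interpret gaussian_field M T f by fact
  \<comment> \<open>The supremum is the same along \<open>L k\<close> enlarged by \<open>t\<close>.\<close>
  let ?L = "\<lambda>k. insert t (L k)"
  have dense: "\<exists>s. (\<forall>k. s k \<in> ?L k) \<and> s \<longlonglongrightarrow> t" if "t \<in> T" for t using L(3)[OF that] by blast
  have m: "{\<omega>\<in>space M. \<exists>t\<in>?L k. \<sigma> t * f t \<omega> + \<mu> t > b} \<in> events" for k
    using L t by (intro exceed_measurable) auto
  have "exceed_prob M f T \<sigma> \<mu> b = prob (\<Union>k. {\<omega>\<in>space M. \<exists>t\<in>?L k. \<sigma> t * f t \<omega> + \<mu> t > b})"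
    by (rule exceed_prob_eq_Union) (use assms L t dense in auto)
  moreover have "prob {\<omega>\<in>space M. \<sigma> t * f t \<omega> + \<mu> t > b}
      \<le> prob (\<Union>k. {\<omega>\<in>space M. \<exists>t\<in>?L k. \<sigma> t * f t \<omega> + \<mu> t > b})"
    using m by (intro finite_measure_mono) auto
  ultimately show ?thesis by simp
qed

theorem theorem1:
  fixes T :: "(real ^ 'd) set"
    and M :: "'w measure"
    and f :: "real ^ 'd \<Rightarrow> 'w \<Rightarrow> real"
    and \<mu>l \<mu>u \<sigma>l \<sigma>u \<beta> \<kappa>H \<beta>' \<kappa>H' \<kappa>m :: real
  assumes "\<mu>l \<le> \<mu>u" and "0 < \<sigma>l" and "\<sigma>l \<le> \<sigma>u" and "\<beta> > 0" and "\<kappa>H > 0"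
    and "compact T"
    and "prob_space M"
    and "std_gaussian_field M T f"
    and "\<kappa>m > 0"
    and "\<And>N :: nat. N > 0 \<Longrightarrow> covering_radius T (lattice_points T N) \<le> ereal (\<kappa>m / real N)"
    and "AE \<omega> in M. continuous_on T (\<lambda>t. f t \<omega>)"
    and "\<beta>' > 0" and "\<kappa>H' > 0"
    and "\<And>s t s' t'. s \<in> T \<Longrightarrow> t \<in> T \<Longrightarrow> s' \<in> T \<Longrightarrow> t' \<in> T \<Longrightarrow>
           \<bar>correlation_fun M f t s - correlation_fun M f t' s'\<bar>
             \<le> \<kappa>H' * (norm (t - t') powr \<beta>' + norm (s - s') powr \<beta>')"
  shows "\<forall>\<epsilon>0 > 0. \<exists>b0 :: real. \<forall>\<epsilon> \<in> {0<..<1}. \<forall>b > b0. \<forall>N :: nat.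
           N > 0 \<longrightarrow> real N \<ge> N0 CARD('d) (min \<beta> \<beta>') \<epsilon>0 \<epsilon> b \<longrightarrow>
           (\<forall>(\<mu>, \<sigma>) \<in> param_class T \<mu>l \<mu>u \<sigma>l \<sigma>u \<beta> \<kappa>H.
              \<bar>exceed_prob M f (lattice_points T N) \<sigma> \<mu> b - exceed_prob M f T \<sigma> \<mu> b\<bar>
                / exceed_prob M f T \<sigma> \<mu> b < \<epsilon>)"
proof (intro allI impI)
  fix \<epsilon>0 :: real assume \<epsilon>0: "\<epsilon>0 > 0"
  interpret prob_space M by fact
  interpret gaussian_field M T f by unfold_locales fact
  have field: "gaussian_field M T f" ..
  define bs where "bs = min \<beta> \<beta>'"
  have bs: "bs > 0" "bs \<le> \<beta>" "bs \<le> \<beta>'" using assms by (auto simp: bs_def)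
  define d where "d = CARD('d)"
  \<comment> \<open>\<open>2 * \<kappa>m\<close> is twice the constant of the covering bound, which
    leaves strict room for choosing a near lattice point. One constant serves
    \<open>\<sigma>\<close>, \<open>\<mu>\<close> and the correlation.\<close>
  define K where "K = \<kappa>H * (2 * \<kappa>m) powr \<beta> + \<kappa>H' * (2 * \<kappa>m) powr \<beta>'"
  have K: "K > 0" using assms by (simp add: K_def add_pos_pos)
  \<comment> \<open>\<open>\<rho> \<ge> 1 / (1 + \<epsilon>0 bs / 2)\<close> gives \<open>N0 powr - \<theta>\<close> a full power of \<open>\<epsilon>\<close>, and \<open>\<rho> \<ge> 3/4\<close> gives it
    \<open>b powr - (3/2)\<close>, which absorbs the factor \<open>b\<close> and the constant.\<close>
  define \<rho> where "\<rho> = max (3/4) (1 / (1 + \<epsilon>0 * bs / 2))"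
  have \<rho>: "3/4 \<le> \<rho>" "1 / (1 + \<epsilon>0 * bs / 2) \<le> \<rho>" "\<rho> < 1"
    using \<epsilon>0 bs by (auto simp: \<rho>_def divide_less_eq add_pos_pos)
  define \<theta> where "\<theta> = bs * \<rho> / 2"
  have \<theta>: "\<theta> > 0" "\<theta> \<le> bs / 2" using \<rho> bs by (auto simp: \<theta>_def)
  define V where "V = K\<^sup>2 + 2 * \<sigma>u\<^sup>2 * K"
  have V: "V > 0" using K by (simp add: V_def add_pos_nonneg)
  \<comment> \<open>For \<open>b > 1\<close> every standardised level is at most
    \<open>CQ * b\<close>; the last summand ensures \<open>CQ * b \<ge> 1\<close>.\<close>
  define CQ where "CQ = (1 + \<bar>\<mu>l\<bar>) / \<sigma>l + 1"
  have CQ: "CQ \<ge> 1" using assms by (simp add: CQ_def)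
  have r_near: "1 - r t t0 \<le> \<kappa>H' * norm (t - t0) powr \<beta>'" if "t \<in> T" "t0 \<in> T" for t t0
    using assms(14)[of t t t t0] that r_same[of t] r_commute[of t t0] by (simp add: abs_le_iff)
  obtain J where J: "finite J" "J \<subseteq> T" "\<And>t. t \<in> T \<Longrightarrow> \<exists>t0\<in>J. r t t0 \<ge> 1/2"
    using compact_cover_correlation[OF assms(6,12,13) r_near] by metis
  obtain Cc where Cc: "Cc > 0" "\<And>n. n > 0 \<Longrightarrow> finite (lattice_points T n)"
    "\<And>n. n > 0 \<Longrightarrow> real (card (lattice_points T n)) \<le> (Cc * real n) ^ d"
    using card_lattice_points_le[OF compact_imp_bounded[OF assms(6)]] unfolding d_def by metis
  \<comment> \<open>The power \<open>real d\<close> counts lattice points, and the extra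
    \<open>\<theta>\<close> lets a factor \<open>\<eta> = n powr - \<theta>\<close> be split off
    from the second term of \<open>increment_bound\<close>.\<close>
  obtain C1 where C1: "\<And>x. x \<ge> 1 \<Longrightarrow> x powr (real d + \<theta>) * exp (- (1 / (8 * V)) * x powr (bs * (1 - \<rho>))) \<le> C1"
    using powr_mult_exp_bounded[of "1 / (8 * V)" "bs * (1 - \<rho>)" "real d + \<theta>"] V bs \<rho> by auto
  have C1pos: "C1 \<ge> 0" by (rule order_trans[OF _ C1[of 1]]) auto
  \<comment> \<open>The constants of both terms of \<open>increment_bound\<close>, once
    \<open>W\<close>, \<open>b\<close> and \<open>\<eta>\<close> are factored out;
    \<open>2 * Cc\<close> reflects that the finer lattice has index \<open>2 * n\<close>.\<close>
  define C2 where "C2 = CQ * exp (3/2) * (card J * (4 / \<sigma>l) + sqrt (2 * pi) * ((2 * Cc) ^ d * C1))"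
  have C2: "C2 \<ge> 0" unfolding C2_def using CQ assms Cc C1pos by simp
  \<comment> \<open>Doubling the lattice index makes the increments decay geometrically with ratio
    \<open>2 powr - \<theta>\<close>.\<close>
  define C3 where "C3 = C2 / (1 - 2 powr - \<theta>)"
  have q1: "0 < 2 powr - \<theta>" "2 powr - \<theta> < 1" using \<theta> by (auto simp: powr_less_one)
  have C3: "C3 \<ge> 0" using C2 q1 by (simp add: C3_def)
  \<comment> \<open>The entries serve, in order, monotonicity of powers of \<open>b\<close>,
    nonnegative standardised levels, the smallness of the mesh, and the final strict
    inequality.\<close>
  define b0 where "b0 = Max {1, \<mu>u, 2 * K * (CQ * (1 + \<sigma>u) + 1), C3\<^sup>2}"
  show "\<exists>b0 :: real. \<forall>\<epsilon> \<in> {0<..<1}. \<forall>b > b0. \<forall>N :: nat.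
           N > 0 \<longrightarrow> real N \<ge> N0 CARD('d) (min \<beta> \<beta>') \<epsilon>0 \<epsilon> b \<longrightarrow>
           (\<forall>(\<mu>, \<sigma>) \<in> param_class T \<mu>l \<mu>u \<sigma>l \<sigma>u \<beta> \<kappa>H.
              \<bar>exceed_prob M f (lattice_points T N) \<sigma> \<mu> b - exceed_prob M f T \<sigma> \<mu> b\<bar>
                / exceed_prob M f T \<sigma> \<mu> b < \<epsilon>)"
  proof (cases "T = {}")
    case True
    \<comment> \<open>Both suprema are minus infinity, so both probabilities are \<open>0\<close>,
      and the quotient is \<open>0\<close> by the convention for division by zero.\<close>
    then show ?thesis by (simp add: exceed_prob_def lattice_points_def)
  next
    case False
    show ?thesis
    proof (intro exI[of _ b0] allI impI ballI, clarify)
      fix \<epsilon> b :: real and N :: nat and \<mu> \<sigma> :: "real ^ 'd \<Rightarrow> real"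
      assume \<epsilon>: "\<epsilon> \<in> {0<..<1}" and "b > b0" and N: "N > 0"
        and NN0: "real N \<ge> N0 CARD('d) (min \<beta> \<beta>') \<epsilon>0 \<epsilon> b"
        and param: "(\<mu>, \<sigma>) \<in> param_class T \<mu>l \<mu>u \<sigma>l \<sigma>u \<beta> \<kappa>H"
      have b: "b > 1" "b > \<mu>u" "b > 2 * K * (CQ * (1 + \<sigma>u) + 1)" "b > C3\<^sup>2"
        using \<open>b > b0\<close> by (auto simp: b0_def)
      note NN0 = NN0[folded bs_def d_def]

      \<comment> \<open>Bounds valid for every member of the parameter class\<close>
      have \<mu>: "\<mu>l \<le> \<mu> t" "\<mu> t \<le> \<mu>u" if "t \<in> T" for t
        using param that by (auto simp: param_class_def)
      have \<sigma>: "\<sigma>l \<le> \<sigma> t" "\<sigma> t \<le> \<sigma>u" if t: "t \<in> T" for t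
      proof -
        have "\<sigma> t > 0" "\<sigma>l\<^sup>2 \<le> (\<sigma> t)\<^sup>2" "(\<sigma> t)\<^sup>2 \<le> \<sigma>u\<^sup>2"
          using param t unfolding param_class_def by auto
        then show "\<sigma>l \<le> \<sigma> t" "\<sigma> t \<le> \<sigma>u"
          using assms by (auto intro: power2_le_imp_le)
      qed
      have hoelder: "\<bar>\<sigma> t - \<sigma> s\<bar> + \<bar>\<mu> t - \<mu> s\<bar> \<le> \<kappa>H * norm (s - t) powr \<beta>" if "s \<in> T" "t \<in> T" for s t
        using param that unfolding param_class_def by auto
      have cont: "continuous_on T \<sigma>" "continuous_on T \<mu>"
        using hoelder by (force intro!: hoelder_continuous_on[OF assms(4), of _ _ \<kappa>H])+
      define L where "L = (\<lambda>k. lattice_points T (N * 2 ^ k))"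
      have Lfin: "finite (L k)" and LT: "L k \<subseteq> T" for k
        using Cc(2) N lattice_points_subset by (auto simp: L_def)
      have close: "\<exists>t'\<in>L k. dist t t' < 2 * \<kappa>m / real (N * 2 ^ k)" if "t \<in> T" for t k
      proof (rule covering_radius_near[OF assms(10) _ that])
        show "0 < N * 2 ^ k" using N by simp
        show "\<kappa>m / real (N * 2 ^ k) < 2 * \<kappa>m / real (N * 2 ^ k)"
          using N assms(9) by (intro divide_strict_right_mono) auto
      qed (auto simp: L_def)
      have dense: "\<exists>s. (\<forall>k. s k \<in> L k) \<and> s \<longlonglongrightarrow> t" if "t \<in> T" for t
      proof -
        have "\<forall>k. \<exists>t'\<in>L k. dist t t' < 2 * \<kappa>m / real (N * 2 ^ k)"
          using close[OF that] by blast
        then obtain s where s: "\<And>k. s k \<in> L k" "\<And>k. dist t (s k) < 2 * \<kappa>m / real (N * 2 ^ k)"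
          by metis
        have "(\<lambda>k. 2 * \<kappa>m / real N * (1/2) ^ k) \<longlonglongrightarrow> 2 * \<kappa>m / real N * 0"
          by (intro tendsto_intros LIMSEQ_power_zero) auto
        then have "(\<lambda>k. 2 * \<kappa>m / real (N * 2 ^ k)) \<longlonglongrightarrow> 0"
          by (simp add: field_simps power_divide)
        then have "(\<lambda>k. dist (s k) t) \<longlonglongrightarrow> 0"
          by (rule Lim_null_comparison[rotated]) (use s(2) in \<open>auto simp: dist_commute intro!: always_eventually less_imp_le\<close>)
        then show ?thesis using s(1) tendsto_dist_iff by blast
      qed

      \<comment> \<open>Exceedance probabilities on the nested lattices\<close>
      define A where "A = (\<lambda>k. {\<omega>\<in>space M. \<exists>t\<in>L k. \<sigma> t * f t \<omega> + \<mu> t > b})"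
      define W where "W = exceed_prob M f T \<sigma> \<mu> b"
      have A: "A k \<in> events" for k
        unfolding A_def using Lfin LT by (rule exceed_measurable)
      have W: "W = prob (\<Union>k. A k)"
        unfolding W_def A_def using field assms(11) cont Lfin LT dense by (rule exceed_prob_eq_Union)
      have P0: "exceed_prob M f (lattice_points T N) \<sigma> \<mu> b = prob (A 0)"
        using exceed_prob_finite[OF field Lfin LT, of 0] by (simp add: L_def A_def)
      have AW: "prob (A k) \<le> W" for k
        unfolding W using A by (intro finite_measure_mono) auto
      define Q where "Q = CQ * b"
      have Q: "Q \<ge> 1" using CQ b mult_mono[of 1 CQ 1 b] by (simp add: Q_def)
      have q: "0 \<le> (b - \<mu> t) / \<sigma> t" "(b - \<mu> t) / \<sigma> t \<le> Q" if t: "t \<in> T" for t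
      proof -
        have s: "\<sigma> t > 0" using \<sigma>[OF t] assms by linarith
        show "0 \<le> (b - \<mu> t) / \<sigma> t" using s \<mu>[OF t] b by simp
        have "\<bar>\<mu>l\<bar> * 1 \<le> \<bar>\<mu>l\<bar> * b" using b by (intro mult_left_mono) auto
        then have *: "b - \<mu> t \<le> (1 + \<bar>\<mu>l\<bar>) * b" using \<mu>[OF t] by (simp add: algebra_simps)
        have "(b - \<mu> t) / \<sigma> t \<le> (1 + \<bar>\<mu>l\<bar>) * b / \<sigma>l"
          using * \<sigma>[OF t] assms b by (intro frac_le) auto
        also have "\<dots> \<le> Q" using b by (simp add: Q_def CQ_def algebra_simps)
        finally show "(b - \<mu> t) / \<sigma> t \<le> Q" .
      qed
      have tail: "std_normal_density ((b - \<mu> t) / \<sigma> t) \<le> exp (3/2) * Q * W" if t: "t \<in> T" for t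
      proof -
        have "\<sigma> t > 0" using \<sigma>[OF t] assms by linarith
        then have eq: "(b - \<mu> t) / \<sigma> t < f t \<omega> \<longleftrightarrow> \<sigma> t * f t \<omega> + \<mu> t > b" for \<omega>
          by (auto simp: field_simps)
        have "std_normal_density ((b - \<mu> t) / \<sigma> t) \<le> exp (3/2) * Q * prob {\<omega>\<in>space M. (b - \<mu> t) / \<sigma> t < f t \<omega>}"
          by (rule tail_ge[OF t q[OF t] Q])
        also have "prob {\<omega>\<in>space M. (b - \<mu> t) / \<sigma> t < f t \<omega>} \<le> W"
          unfolding eq W_def using field assms(11) cont Lfin LT dense t by (rule exceed_prob_ge_single)
        finally show ?thesis using Q by (simp add: mult_left_mono)
      qed
      \<comment> \<open>The quotient in the claim needs a positive denominator; a single point of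
        \<open>T\<close> provides it through \<open>tail\<close>.\<close>
      have Wpos: "W > 0"
      proof -
        obtain t where t: "t \<in> T" using False by auto
        have "0 < exp (3/2) * Q * W"
          using tail[OF t] normal_density_pos[of 1 0 "(b - \<mu> t) / \<sigma> t"] by linarith
        then show ?thesis using Q by (intro zero_less_mult_pos[of "exp (3/2) * Q" W]) auto
      qed
      have incr: "prob (A (Suc k)) - prob (A k) \<le> W * b * C2 * real (N * 2 ^ k) powr - \<theta>" for k
      proof -
        define n where "n = N * 2 ^ k"
        have n: "n > 0" "n \<ge> N" using N by (auto simp: n_def)
        define x where "x = real n powr - bs"
        have x: "0 < x" "x \<le> 1" using n bs powr_mono[of "- bs" 0 "real n"] by (auto simp: x_def)
        define \<eta> where "\<eta> = real n powr - \<theta>"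
        have \<eta>: "\<eta> > 0" using n by (simp add: \<eta>_def)
        have near: "\<exists>t'\<in>L k. \<bar>\<sigma> t - \<sigma> t'\<bar> \<le> K * x \<and> \<bar>\<mu> t - \<mu> t'\<bar> \<le> K * x \<and> 1 - r t t' \<le> K * x"
          if t: "t \<in> T" for t
        proof -
          obtain t' where t': "t' \<in> L k" "dist t t' < 2 * \<kappa>m / real n"
            using close[OF t, of k] by (auto simp: n_def)
          have t'T: "t' \<in> T" using t' LT by auto
          have nrm: "norm (t' - t) \<le> 2 * \<kappa>m / real n" "norm (t - t') \<le> 2 * \<kappa>m / real n"
            using t' by (auto simp: dist_norm norm_minus_commute)
          have "\<bar>\<sigma> t - \<sigma> t'\<bar> + \<bar>\<mu> t - \<mu> t'\<bar> \<le> \<kappa>H * norm (t' - t) powr \<beta>"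
            by (rule hoelder[OF t'T t])
          also have "\<dots> \<le> \<kappa>H * ((2 * \<kappa>m) powr \<beta> * x)"
            unfolding x_def using nrm n bs assms by (intro mult_left_mono powr_scale_le) auto
          also have "\<dots> \<le> K * x"
            using x assms by (simp add: K_def algebra_simps)
          finally have 1: "\<bar>\<sigma> t - \<sigma> t'\<bar> + \<bar>\<mu> t - \<mu> t'\<bar> \<le> K * x" .
          have "1 - r t t' \<le> \<kappa>H' * norm (t - t') powr \<beta>'" by (rule r_near[OF t t'T])
          also have "\<dots> \<le> \<kappa>H' * ((2 * \<kappa>m) powr \<beta>' * x)"
            unfolding x_def using nrm n bs assms by (intro mult_left_mono powr_scale_le) auto
          also have "\<dots> \<le> K * x"
            using x assms by (simp add: K_def algebra_simps)
          finally show ?thesis using 1 t' by (intro bexI[of _ t']) auto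
        qed
        \<comment> \<open>\<open>N0_ge_power\<close> supplies two factors \<open>b\<close>: one
          dominates the constant by the choice of \<open>b0\<close>, the other is the
          \<open>b\<close> in \<open>Q\<close>.\<close>
        have cond: "(Q * (1 + \<sigma>u) + 1) * (K * x) \<le> \<eta> / 2"
        proof -
          have "b\<^sup>2 \<le> real N powr (bs / 2)"
            by (rule N0_ge_power[OF bs(1) \<epsilon>0 _ _ _ NN0]) (use \<epsilon> b in auto)
          also have "\<dots> \<le> real n powr (bs / 2)" using n bs by (intro powr_mono2) auto
          also have "\<dots> \<le> real n powr (bs - \<theta>)" using n \<theta> by (intro powr_mono) auto
          finally have 1: "b\<^sup>2 \<le> real n powr (bs - \<theta>)" .
          have "Q * (1 + \<sigma>u) + 1 \<le> (CQ * (1 + \<sigma>u) + 1) * b"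
            using b by (simp add: Q_def algebra_simps)
          then have "2 * K * (Q * (1 + \<sigma>u) + 1) \<le> 2 * K * ((CQ * (1 + \<sigma>u) + 1) * b)"
            using K by (intro mult_left_mono) auto
          also have "\<dots> \<le> b * b" using b mult_right_mono[OF less_imp_le[OF b(3)], of b] by (simp add: mult.assoc)
          finally have "2 * K * (Q * (1 + \<sigma>u) + 1) \<le> real n powr (bs - \<theta>)"
            using 1 by (simp add: power2_eq_square)
          then have "2 * K * (Q * (1 + \<sigma>u) + 1) * x \<le> real n powr (bs - \<theta>) * x"
            using x by (intro mult_right_mono) auto
          also have "\<dots> = \<eta>" using n by (simp add: x_def \<eta>_def flip: powr_add)
          finally show ?thesis by (simp add: algebra_simps)
        qed
        have bound: "prob (A (Suc k)) - prob (A k) \<le> card J * (\<eta> / (\<sigma>l / 2) * (2 * (exp (3/2) * Q * W)))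
            + card (L (Suc k)) * (sqrt (2 * pi) * (exp (3/2) * Q * W) * exp (- \<eta>\<^sup>2 / (8 * (K\<^sup>2 + 2 * \<sigma>u\<^sup>2 * K) * x)))"
          unfolding A_def
        proof (rule increment_bound)
          show "\<And>t. t \<in> L (Suc k) \<Longrightarrow> \<exists>t0\<in>J. r t t0 \<ge> 1/2" using J LT by blast
          show "\<And>t. t \<in> L (Suc k) \<Longrightarrow> \<exists>t'\<in>L k. \<bar>\<sigma> t - \<sigma> t'\<bar> \<le> K * x \<and> \<bar>\<mu> t - \<mu> t'\<bar> \<le> K * x \<and> 1 - r t t' \<le> K * x"
            using near LT by blast
          show "prob {\<omega>\<in>space M. \<exists>t\<in>L (Suc k). \<sigma> t * f t \<omega> + \<mu> t > b} \<le> W"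
            using AW[of "Suc k"] by (simp add: A_def)
        qed (use Lfin LT J assms \<sigma> x K q Q \<eta> cond tail in auto)
        \<comment> \<open>Since \<open>2 * \<theta> = bs * \<rho>\<close> and
          \<open>\<rho> < 1\<close>, this is a positive power of \<open>n\<close>, so the
          exponential factor beats the number of lattice points.\<close>
        have "\<eta>\<^sup>2 / x = real n powr (bs * (1 - \<rho>))"
          using n by (simp add: \<eta>_def x_def power2_eq_square \<theta>_def powr_minus field_simps flip: powr_add)
        then have e: "- \<eta>\<^sup>2 / (8 * (K\<^sup>2 + 2 * \<sigma>u\<^sup>2 * K) * x) = - (1 / (8 * V)) * real n powr (bs * (1 - \<rho>))"
          unfolding V_def[symmetric] using V x by (simp add: field_simps)
        define E where "E = exp (- (1 / (8 * V)) * real n powr (bs * (1 - \<rho>)))"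
        have "real (card (L (Suc k))) \<le> (Cc * real (2 * n)) ^ d"
          using Cc(3)[of "2 * n"] n by (simp add: L_def n_def mult_ac)
        then have "card (L (Suc k)) * E \<le> (Cc * real (2 * n)) ^ d * E"
          by (intro mult_right_mono) (auto simp: E_def)
        \<comment> \<open>Uses \<open>n ^ d = n powr (d + \<theta>) * \<eta>\<close> to reach the
          form bounded by \<open>C1\<close>.\<close>
        also have "\<dots> = (2 * Cc) ^ d * (real n powr (real d + \<theta>) * E) * \<eta>"
          using n by (simp add: \<eta>_def powr_add powr_realpow powr_minus power_mult_distrib)
        also have "\<dots> \<le> (2 * Cc) ^ d * C1 * \<eta>"
          using C1[of "real n"] n Cc \<eta> by (intro mult_right_mono mult_left_mono) (auto simp: E_def)
        finally have cardE: "card (L (Suc k)) * E \<le> (2 * Cc) ^ d * C1 * \<eta>" .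
        have "card (L (Suc k)) * (sqrt (2 * pi) * (exp (3/2) * Q * W) * E)
            = sqrt (2 * pi) * (exp (3/2) * Q * W) * (card (L (Suc k)) * E)" by simp
        also have "\<dots> \<le> sqrt (2 * pi) * (exp (3/2) * Q * W) * ((2 * Cc) ^ d * C1 * \<eta>)"
          using cardE Q Wpos by (intro mult_left_mono) auto
        finally have "prob (A (Suc k)) - prob (A k) \<le> card J * (\<eta> / (\<sigma>l / 2) * (2 * (exp (3/2) * Q * W)))
            + sqrt (2 * pi) * (exp (3/2) * Q * W) * ((2 * Cc) ^ d * C1 * \<eta>)"
          using bound unfolding e E_def[symmetric] by linarith
        also have "\<dots> = W * b * C2 * \<eta>"
          using assms(2) by (simp add: C2_def Q_def field_simps)
        finally show ?thesis by (simp add: \<eta>_def n_def)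
      qed

      \<comment> \<open>Summation of the increments\<close>
      have part: "prob (A k) \<le> prob (A 0) + W * b * C3 * real N powr - \<theta>" for k
      proof -
        have geo: "real (N * 2 ^ j) powr - \<theta> = real N powr - \<theta> * (2 powr - \<theta>) ^ j" for j
        proof -
          have "(2 ^ j) powr - \<theta> = (2 powr - \<theta>) ^ j"
            by (simp add: powr_realpow[symmetric] powr_powr mult.commute)
          then show ?thesis by (simp add: powr_mult)
        qed
        have "prob (A k) - prob (A 0) = (\<Sum>j<k. prob (A (Suc j)) - prob (A j))"
          using sum_lessThan_telescope[of "\<lambda>k. prob (A k)" k] by simp
        also have "\<dots> \<le> (\<Sum>j<k. W * b * C2 * real (N * 2 ^ j) powr - \<theta>)"
          by (intro sum_mono incr)
        also have "\<dots> = W * b * C2 * real N powr - \<theta> * (\<Sum>j<k. (2 powr - \<theta>) ^ j)"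
          by (simp only: geo sum_distrib_left mult.assoc)
        also have "\<dots> \<le> W * b * C2 * real N powr - \<theta> * (1 / (1 - 2 powr - \<theta>))"
        proof (intro mult_left_mono)
          have "(\<Sum>j<k. (2 powr - \<theta>) ^ j) \<le> (\<Sum>j. (2 powr - \<theta>) ^ j)"
            using q1 by (intro sum_le_suminf summable_geometric) auto
          then show "(\<Sum>j<k. (2 powr - \<theta>) ^ j) \<le> 1 / (1 - 2 powr - \<theta>)"
            using q1 by (simp add: suminf_geometric)
        qed (use Wpos b C2 in auto)
        also have "\<dots> = W * b * C3 * real N powr - \<theta>" by (simp add: C3_def)
        finally show ?thesis by simp
      qed
      \<comment> \<open>The factor \<open>b\<close> of the summed increments meets
        \<open>b powr - (3/2)\<close> from \<open>N0_powr_le\<close>; the remaining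
        \<open>1 / sqrt b\<close> absorbs \<open>C3\<close> because
        \<open>b > C3\<^sup>2\<close>.\<close>
      have pw: "b powr 1 * b powr (- (3/2)) = 1 / sqrt b"
      proof -
        have "b powr 1 * b powr (- (3/2)) = b powr (- (1/2))" by (simp only: powr_add[symmetric]) simp
        also have "\<dots> = 1 / sqrt b" unfolding powr_minus_divide using b by (simp add: powr_half_sqrt)
        finally show ?thesis .
      qed
      have "incseq A"
      proof (rule incseq_SucI)
        fix k
        have "L k \<subseteq> L (Suc k)"
          using lattice_points_double[of T "N * 2 ^ k"] by (simp add: L_def mult_ac)
        then show "A k \<subseteq> A (Suc k)" by (auto simp: A_def)
      qed
      \<comment> \<open>Continuity from below; the bound \<open>part\<close> is uniform in
        \<open>k\<close> and therefore survives the limit.\<close>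
      then have "(\<lambda>k. prob (A k)) \<longlonglongrightarrow> W"
        unfolding W using A by (intro finite_Lim_measure_incseq) auto
      then have "W \<le> prob (A 0) + W * b * C3 * real N powr - \<theta>"
        by (rule LIMSEQ_le_const2) (use part in auto)
      also have "real N powr - \<theta> \<le> b powr (- (3/2)) * \<epsilon>"
        unfolding \<theta>_def using \<rho> by (intro N0_powr_le[OF bs(1) \<epsilon>0 _ _ _ NN0]) (use \<epsilon> b in auto)
      finally have "W - prob (A 0) \<le> W * b * C3 * (b powr (- (3/2)) * \<epsilon>)"
        using Wpos b C3 by (simp add: mult_left_mono)
      also have "\<dots> = W * \<epsilon> * (C3 * (b powr 1 * b powr (- (3/2))))"
        using b by simp
      also note pw
      also have "W * \<epsilon> * (C3 * (1 / sqrt b)) < W * \<epsilon> * 1"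
      proof (intro mult_strict_left_mono)
        have "C3 < sqrt b" using b C3 by (simp add: real_less_rsqrt)
        then show "C3 * (1 / sqrt b) < 1" using b by (simp add: divide_less_eq)
      qed (use Wpos \<epsilon> in auto)
      finally have "W - prob (A 0) < \<epsilon> * W" by (simp add: mult.commute)
      then show "\<bar>exceed_prob M f (lattice_points T N) \<sigma> \<mu> b - exceed_prob M f T \<sigma> \<mu> b\<bar>
                / exceed_prob M f T \<sigma> \<mu> b < \<epsilon>"
        unfolding P0 W_def[symmetric] using AW[of 0] Wpos by (simp add: divide_less_eq)
    qed
  qed
qed

end
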